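(* Let $P=\{\lambda\in\mathbb C:\tfrac12<|\lambda|<\tfrac32\}$, let $\mathbb D\subset\mathbb C$ be the open unit disc, let $$S:=\Bigl\{(z_1,z_2)=(x_1+iy_1,z_2)\in P\times\mathbb D:\ (x_1-1)^2+\frac{1+|z_2|^2}{1-|z_2|^2}\,y_1^2=\frac14,\ y_1>0\Bigr\},$$ and let $D:=(P\times\mathbb D)\setminus S\subset\mathbb C^2$. Then there is a function $f\in L_h^2(D)$ such that $\limsup_{D\ni z\to a}|f(z)|=\infty$ for every $a\in\partial D$.
   Context: $L_h^2(D):=L^2(D)\cap\mathcal O(D)$ is the space of holomorphic functions on $D$ that are square-integrable with respect to Lebesgue measure. Here $x_1,y_1$ are the real and imaginary parts of $z_1$. *)

theory Defs
  imports "HOL-Complex_Analysis.Complex_Analysis"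
begin

text \<open>
  \<open>\<complex>\<^sup>2\<close> is the type \<^typ>\<open>complex \<times> complex\<close>, whose norm, topology and Lebesgue measure are
  those of \<open>\<real>\<^sup>4\<close>.
\<close>

text \<open>
  Complex Frechet differentiability at every point: the real derivative exists and is
  complex-linear, hence of the form \<open>h \<mapsto> a h\<^sub>1 + b h\<^sub>2\<close>. As for \<^const>\<open>holomorphic_on\<close>,
  the notion is the usual one for open sets \<open>D\<close>.
\<close>
definition holomorphic2_on :: "(complex \<times> complex \<Rightarrow> complex) \<Rightarrow> (complex \<times> complex) set \<Rightarrow> bool"
  where "holomorphic2_on f D \<longleftrightarrow>
    (\<forall>z\<in>D. \<exists>a b. (f has_derivative (\<lambda>h. a * fst h + b * snd h)) (at z within D))"

definition square_integrable_on :: "('a::euclidean_space \<Rightarrow> complex) \<Rightarrow> 'a set \<Rightarrow> bool"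
  where "square_integrable_on f D \<longleftrightarrow>
    set_borel_measurable lebesgue D f \<and> set_integrable lebesgue D (\<lambda>z. (cmod (f z))\<^sup>2)"

text \<open>Elements are total functions; only their values on \<open>D\<close> matter.\<close>
definition L2h :: "(complex \<times> complex) set \<Rightarrow> (complex \<times> complex \<Rightarrow> complex) set"
  where "L2h D = {f. square_integrable_on f D \<and> holomorphic2_on f D}"

definition annulus_P :: "complex set"
  where "annulus_P = {l. 1/2 < cmod l \<and> cmod l < 3/2}"

definition slit_S :: "(complex \<times> complex) set"
  where "slit_S = {(z1, z2) \<in> annulus_P \<times> ball 0 1.
    (Re z1 - 1)\<^sup>2 + (1 + (cmod z2)\<^sup>2) / (1 - (cmod z2)\<^sup>2) * (Im z1)\<^sup>2 = 1/4 \<and> Im z1 > 0}"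

definition dom_D :: "(complex \<times> complex) set"
  where "dom_D = annulus_P \<times> ball 0 1 - slit_S"

end

theory Submission
  imports Defs
begin

text \<open>
  Each fibre of the domain over a fixed \<open>z\<^sub>2\<close> is an annulus cut along the upper half of an ellipse
  that joins the two boundary circles. With \<open>u = 2 (z\<^sub>1 - 1)\<close> the full ellipse is
  \<open>(Re u)\<^sup>2 + (Im u / k)\<^sup>2 = 1\<close>, where \<open>k\<close> depends on \<open>|z\<^sub>2|\<close>. The region under the arc is pseudoconvex
  along the slit. Functions holomorphic near the other side of the slit may continue across it, but
  then they arrive on another sheet over the annulus, because no loop in the cut annulus surrounds
  the origin. So it is no contradiction that a function blows up along the slit from below.

  The function is built by a gliding hump. Suppose that at every frontier point \<open>a\<close> there is a
  holomorphic \<open>h\<close> with \<open>|h| < 1\<close> on the domain whose modulus takes values arbitrarily close to \<open>1\<close>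
  near \<open>a\<close>. High powers \<open>M h\<^sup>n\<close> are then small on compact sets and, by dominated convergence, small
  in \<open>L\<^sup>2\<close>, yet large somewhere near \<open>a\<close> (\<open>weak_peak_hump\<close>). Each such bump is bounded, so bumps can be
  superposed one after the other along a sequence that visits a dense set of frontier points
  infinitely often, each new bump overpowering the bound of all earlier ones (\<open>gliding_hump\<close>).
  The sum is holomorphic and square integrable and has large values near every frontier point.

  It remains to find the functions \<open>h\<close>. At frontier points of the product
  of the annulus and the disc, the functions \<open>z\<^sub>2\<close>, \<open>2 z\<^sub>1 / 3\<close> and \<open>1 / (2 z\<^sub>1)\<close> do. At a point \<open>a\<close> of the slit
  one uses a holomorphic graph \<open>u = q(z\<^sub>2)\<close> over the whole unit disc that lies in the upper half
  plane, stays outside all the ellipses and touches the slit at \<open>a\<close> (\<open>tangent_curve\<close>). Let \<open>l\<close> be the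
  branch of \<open>log z\<^sub>1\<close> on the domain that is principal under the arc, and let \<open>Q(z\<^sub>2) = log (1 + q(z\<^sub>2)/2)\<close>.
  A point under the arc cannot be reached from the curve by increasing the argument, since rotating
  it back would keep it inside the ellipse; and on the rest of the domain the branch has
  nonpositive imaginary part. Hence \<open>l - Q\<close> omits the ray of nonnegative multiples of \<open>\<i>\<close>
  (\<open>log_branch_avoids_ray\<close>), the principal root of \<open>\<i> (l - Q)\<close> has positive real part, and
  \<open>h = 1 / (1 + sqrt (\<i> (l - Q)))\<close> has the required property (\<open>weak_peak_slit\<close>).
\<close>

section \<open>Holomorphic functions of two variables\<close>

lemma holomorphic2_on_open:
  assumes "open D"
  shows "holomorphic2_on f D \<longleftrightarrow>
    (\<forall>z\<in>D. \<exists>a b. (f has_derivative (\<lambda>h. a * fst h + b * snd h)) (at z))"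
  unfolding holomorphic2_on_def by (intro ball_cong refl) (simp only: at_within_open[OF _ assms])

lemma holomorphic2_on_imp_continuous_on:
  "holomorphic2_on f D \<Longrightarrow> continuous_on D f"
  unfolding holomorphic2_on_def continuous_on_eq_continuous_within
  by (meson has_derivative_continuous)

lemma holomorphic2_on_fst: "holomorphic2_on fst D"
  unfolding holomorphic2_on_def
  by (intro ballI exI[of _ 1] exI[of _ 0]) (auto intro!: derivative_eq_intros)

lemma holomorphic2_on_snd: "holomorphic2_on snd D"
  unfolding holomorphic2_on_def
  by (intro ballI exI[of _ 0] exI[of _ 1]) (auto intro!: derivative_eq_intros)

lemma holomorphic2_on_diff:
  assumes "holomorphic2_on f D" "holomorphic2_on g D"
  shows "holomorphic2_on (\<lambda>z. f z - g z) D"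
  unfolding holomorphic2_on_def
proof
  fix z assume "z \<in> D"
  with assms obtain a b c d
    where "(f has_derivative (\<lambda>h. a * fst h + b * snd h)) (at z within D)"
      and "(g has_derivative (\<lambda>h. c * fst h + d * snd h)) (at z within D)"
    unfolding holomorphic2_on_def by meson
  then have "((\<lambda>z. f z - g z) has_derivative (\<lambda>h. (a - c) * fst h + (b - d) * snd h)) (at z within D)"
    by (auto intro!: derivative_eq_intros simp: algebra_simps)
  then show "\<exists>a b. ((\<lambda>z. f z - g z) has_derivative (\<lambda>h. a * fst h + b * snd h)) (at z within D)"
    by blast
qed

lemma holomorphic2_on_compose:
  assumes "holomorphic2_on f D" "\<phi> holomorphic_on U" "open U" "\<And>z. z \<in> D \<Longrightarrow> f z \<in> U"
  shows "holomorphic2_on (\<lambda>z. \<phi> (f z)) D"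
  unfolding holomorphic2_on_def
proof
  fix z assume z: "z \<in> D"
  with assms(1) obtain a b
    where f: "(f has_derivative (\<lambda>h. a * fst h + b * snd h)) (at z within D)"
    unfolding holomorphic2_on_def by meson
  have "(\<phi> has_derivative (*) (deriv \<phi> (f z))) (at (f z))"
    using holomorphic_derivI[OF assms(2,3) assms(4)[OF z]] by (simp add: has_field_derivative_def)
  from has_derivative_compose[OF f this]
  have "((\<lambda>z. \<phi> (f z)) has_derivative
      (\<lambda>h. (deriv \<phi> (f z) * a) * fst h + (deriv \<phi> (f z) * b) * snd h)) (at z within D)"
    by (simp add: algebra_simps)
  then show "\<exists>a b. ((\<lambda>z. \<phi> (f z)) has_derivative (\<lambda>h. a * fst h + b * snd h)) (at z within D)"
    by blast
qed

lemma holomorphic2_on_cong: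
  assumes "holomorphic2_on g D" "\<And>z. z \<in> D \<Longrightarrow> f z = g z"
  shows "holomorphic2_on f D"
  unfolding holomorphic2_on_def
proof
  fix z assume "z \<in> D"
  with assms obtain a b where "(g has_derivative (\<lambda>h. a * fst h + b * snd h)) (at z within D)"
    unfolding holomorphic2_on_def by meson
  then have "(f has_derivative (\<lambda>h. a * fst h + b * snd h)) (at z within D)"
    by (rule has_derivative_transform[OF \<open>z \<in> D\<close>, rotated]) (rule assms(2))
  then show "\<exists>a b. (f has_derivative (\<lambda>h. a * fst h + b * snd h)) (at z within D)" by blast
qed

lemma holomorphic2_on_Un:
  assumes "open U" "open V" "holomorphic2_on f U" "holomorphic2_on f V"
  shows "holomorphic2_on f (U \<union> V)"
  using assms(3,4)
  unfolding holomorphic2_on_open[OF assms(1)] holomorphic2_on_open[OF assms(2)]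
    holomorphic2_on_open[OF open_Un[OF assms(1,2)]]
  by blast

text \<open>
  The one-variable Cauchy inequality on the complex line through \<open>z\<close> in a unit direction \<open>e\<close>
  bounds the derivative applied to \<open>e\<close>; the two coordinate directions give the two coefficients.
\<close>
lemma Cauchy_estimate2:
  assumes D: "open D" and g: "holomorphic2_on g D"
    and sub: "cball z r \<subseteq> D" and r: "0 < r"
    and B: "\<And>w. w \<in> cball z r \<Longrightarrow> cmod (g w) \<le> B"
    and der: "(g has_derivative (\<lambda>h. a * fst h + b * snd h)) (at z)"
  shows "cmod a \<le> B / r" "cmod b \<le> B / r"
proof -
  have dir: "cmod (a * fst e + b * snd e) \<le> B / r" if e: "norm e = 1" for e :: "complex \<times> complex"
  proof -
    define line where "line t = z + (t * fst e, t * snd e)" for t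
    have dist: "dist z (line t) = cmod t" for t
    proof -
      have "dist z (line t) = norm (t * fst e, t * snd e)"
        unfolding line_def dist_norm by (metis add_diff_cancel_left' norm_minus_commute)
      also have "\<dots> = sqrt ((cmod t)\<^sup>2 * ((cmod (fst e))\<^sup>2 + (cmod (snd e))\<^sup>2))"
        by (simp add: norm_Pair norm_mult power_mult_distrib algebra_simps)
      also have "\<dots> = cmod t * norm e"
        by (simp add: real_sqrt_mult norm_prod_def)
      finally show ?thesis using e by simp
    qed
    have line_in: "line t \<in> cball z r" if "t \<in> cball 0 r" for t
      using that dist by simp
    have line_der: "(line has_derivative (\<lambda>h. (h * fst e, h * snd e))) (at t)" for t
      unfolding line_def by (auto intro!: derivative_eq_intros)
    have comp: "((\<lambda>t. g (line t)) has_field_derivative (c * fst e + d * snd e)) (at t)"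
      if "(g has_derivative (\<lambda>h. c * fst h + d * snd h)) (at (line t))" for t c d
      unfolding has_field_derivative_def
      by (rule has_derivative_eq_rhs[OF has_derivative_compose[OF line_der that]])
        (auto simp: algebra_simps)
    have holo: "\<exists>g'. ((\<lambda>t. g (line t)) has_field_derivative g') (at t)" if "t \<in> cball 0 r" for t
    proof -
      have "line t \<in> D" using line_in[OF that] sub by blast
      then show ?thesis
        using g comp unfolding holomorphic2_on_open[OF D] by meson
    qed
    have "continuous_on (cball 0 r) (\<lambda>t. g (line t))"
      using holo by (meson DERIV_isCont continuous_at_imp_continuous_on)
    moreover have "(\<lambda>t. g (line t)) holomorphic_on ball 0 r"
      using holo unfolding holomorphic_on_open[OF open_ball] by (simp add: less_imp_le)
    moreover have "cmod (g (line t)) \<le> B" if "cmod (0 - t) = r" for t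
      by (rule B[OF line_in]) (use that in simp)
    ultimately have "cmod ((deriv ^^ 1) (\<lambda>t. g (line t)) 0) \<le> fact 1 * B / r ^ 1"
      by (intro Cauchy_inequality r)
    moreover have "deriv (\<lambda>t. g (line t)) 0 = a * fst e + b * snd e"
      using der by (intro DERIV_imp_deriv comp) (simp add: line_def zero_prod_def[symmetric])
    ultimately show ?thesis by simp
  qed
  have unit: "norm (1::complex, 0::complex) = 1" "norm (0::complex, 1::complex) = 1"
    by (simp_all add: norm_Pair)
  show "cmod a \<le> B / r" using dir[OF unit(1)] by simp
  show "cmod b \<le> B / r" using dir[OF unit(2)] by simp
qed

text \<open>
  For \<open>r\<close> decreasing to \<open>0\<close> these sets exhaust an open set; in a bounded one they are compact.
\<close>
definition inner_part :: "'a::metric_space set \<Rightarrow> real \<Rightarrow> 'a set"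
  where "inner_part D r = {z. ball z r \<subseteq> D}"

lemma inner_part_subset: "0 < r \<Longrightarrow> inner_part D r \<subseteq> D"
  unfolding inner_part_def using centre_in_ball by blast

lemma compact_inner_part:
  fixes D :: "'a::heine_borel set"
  assumes "bounded D" "0 < r"
  shows "compact (inner_part D r)"
proof -
  have "- inner_part D r = (\<Union>w\<in>-D. ball w r)"
    by (auto simp: inner_part_def dist_commute)
  then have "closed (inner_part D r)" unfolding closed_def
    by (metis open_UN open_ball)
  moreover have "bounded (inner_part D r)"
    by (rule bounded_subset[OF assms(1) inner_part_subset[OF assms(2)]])
  ultimately show ?thesis by (simp add: compact_eq_bounded_closed)
qed

text \<open>
  A Weierstrass theorem. The bounds on the exhausting sets become, near a given point and for all
  late terms, uniform geometric bounds on a ball; the Cauchy estimate carries them over to the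
  derivatives, so that the series may be differentiated term by term.
\<close>
lemma holomorphic2_on_series:
  assumes D: "open D" and g: "\<And>k. holomorphic2_on (g k) D"
    and small: "\<And>k z. z \<in> inner_part D (1 / Suc k) \<Longrightarrow> cmod (g k z) \<le> (1/2) ^ k"
  shows "\<And>z. z \<in> D \<Longrightarrow> summable (\<lambda>k. cmod (g k z))"
    and "holomorphic2_on (\<lambda>z. \<Sum>k. g k z) D"
proof -
  have geo: "summable (\<lambda>k. (1/2::real) ^ k)" by (simp add: summable_geometric)
  have loc: "\<exists>r>0. \<exists>N. cball z (2 * r) \<subseteq> D \<and>
      (\<forall>k\<ge>N. \<forall>w\<in>cball z (2 * r). cmod (g k w) \<le> (1/2) ^ k)"
    if z: "z \<in> D" for z
  proof -
    obtain R where R: "R > 0" "ball z R \<subseteq> D" using D z openE by blast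
    obtain N where N: "1 / Suc N < R / 2" using R(1) nat_approx_posE[of "R / 2"] by auto
    have "w \<in> inner_part D (1 / Suc k)" if "k \<ge> N" "w \<in> cball z (R / 2)" for k w
    proof -
      have "1 / Suc k \<le> 1 / Suc N" using that(1) by (simp add: field_simps)
      then have "1 / Suc k < R / 2" using N by linarith
      have "ball w (1 / Suc k) \<subseteq> ball z R"
      proof
        fix y assume "y \<in> ball w (1 / Suc k)"
        with \<open>1 / Suc k < R / 2\<close> that(2) show "y \<in> ball z R"
          using dist_triangle[of z y w] by auto
      qed
      then show ?thesis using R(2) by (auto simp: inner_part_def)
    qed
    then show ?thesis
      using R small by (intro exI[of _ "R/4"] conjI exI[of _ N]) (auto simp: subset_iff)
  qed
  show summ: "summable (\<lambda>k. cmod (g k z))" if z: "z \<in> D" for z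
  proof -
    obtain r N where "r > 0" "\<forall>k\<ge>N. \<forall>w\<in>cball z (2*r). cmod (g k w) \<le> (1/2) ^ k"
      using loc[OF z] by blast
    then have "\<forall>k\<ge>N. norm (cmod (g k z)) \<le> (1/2) ^ k" by auto
    then show ?thesis by (intro summable_comparison_test[OF _ geo]) blast
  qed
  obtain a b where der: "\<And>k z. z \<in> D \<Longrightarrow>
      (g k has_derivative (\<lambda>h. a k z * fst h + b k z * snd h)) (at z)"
    using g unfolding holomorphic2_on_open[OF D] by metis
  show "holomorphic2_on (\<lambda>z. \<Sum>k. g k z) D"
    unfolding holomorphic2_on_open[OF D]
  proof
    fix z assume z: "z \<in> D"
    then obtain r N where r: "r > 0" and sub: "cball z (2*r) \<subseteq> D"
      and bd: "\<And>k w. k \<ge> N \<Longrightarrow> w \<in> cball z (2*r) \<Longrightarrow> cmod (g k w) \<le> (1/2) ^ k"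
      using loc by metis
    have sub1: "cball w r \<subseteq> cball z (2*r)" if "w \<in> ball z r" for w
    proof
      fix y assume "y \<in> cball w r"
      with that show "y \<in> cball z (2*r)" using dist_triangle[of z y w] by auto
    qed
    have sub2: "ball z r \<subseteq> D" using r sub by auto
    have coeff: "cmod (a k w) \<le> (1/2)^k / r" "cmod (b k w) \<le> (1/2)^k / r"
      if "k \<ge> N" "w \<in> ball z r" for k w
    proof -
      have "cball w r \<subseteq> D" using sub1[OF that(2)] sub by (rule order_trans)
      moreover have "cmod (g k y) \<le> (1/2)^k" if "y \<in> cball w r" for y
        using bd[OF \<open>k \<ge> N\<close>] sub1[OF \<open>w \<in> ball z r\<close>] that by blast
      moreover have "w \<in> D" using sub2 that(2) by blast
      ultimately show "cmod (a k w) \<le> (1/2)^k / r" "cmod (b k w) \<le> (1/2)^k / r"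
        using Cauchy_estimate2[OF D g _ r _ der] by blast+
    qed
    have geo_r: "summable (\<lambda>k. (1/2::real) ^ k / r)" using geo by (rule summable_divide)
    have sums: "summable (\<lambda>k. a k w)" "summable (\<lambda>k. b k w)" if "w \<in> ball z r" for w
      using coeff[OF _ that] by (auto intro: summable_comparison_test[OF _ geo_r])
    define g' where "g' w h = (\<Sum>k. a k w) * fst h + (\<Sum>k. b k w) * snd h" for w h
    \<comment> \<open>Common bound for the remainders of both coefficient series.\<close>
    define tail where "tail n = (\<Sum>k. (1/2::real)^(k+n) / r)" for n
    have tail0: "tail \<longlonglongrightarrow> 0"
      unfolding tail_def using suminf_exist_split2[OF geo_r] by simp
    have rest: "cmod ((\<Sum>k<n. c k) - (\<Sum>k. c k)) \<le> tail n"
      if "summable c" "\<And>k. k \<ge> N \<Longrightarrow> cmod (c k) \<le> (1/2)^k / r" "n \<ge> N" for c :: "nat \<Rightarrow> complex" and n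
    proof -
      have "(\<Sum>k<n. c k) - (\<Sum>k. c k) = - (\<Sum>k. c (k+n))"
        using suminf_split_initial_segment[OF that(1), of n] by simp
      moreover have "cmod (\<Sum>k. c (k+n)) \<le> tail n"
        unfolding tail_def
        using that by (intro norm_suminf_le summable_ignore_initial_segment[OF geo_r]) auto
      ultimately show ?thesis by simp
    qed
    have conv: "\<forall>\<^sub>F n in sequentially. \<forall>w\<in>ball z r. \<forall>h.
        cmod ((\<Sum>k<n. a k w * fst h + b k w * snd h) - g' w h) \<le> e * norm h" if e: "e > 0" for e
    proof -
      have "\<forall>\<^sub>F n in sequentially. tail n < e / 2"
        using tail0 e by (intro order_tendstoD(2)) auto
      then show ?thesis
      proof (rule eventually_elim2[OF _ eventually_ge_at_top[of N]], intro ballI allI)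
        fix n w and h :: "complex \<times> complex"
        assume n: "tail n < e / 2" "N \<le> n" and w: "w \<in> ball z r"
        have "(\<Sum>k<n. a k w * fst h + b k w * snd h) - g' w h =
            ((\<Sum>k<n. a k w) - (\<Sum>k. a k w)) * fst h + ((\<Sum>k<n. b k w) - (\<Sum>k. b k w)) * snd h"
          by (simp add: g'_def sum.distrib sum_distrib_left algebra_simps)
        also have "cmod \<dots> \<le> tail n * norm h + tail n * norm h"
        proof (rule norm_triangle_mono)
          show "cmod (((\<Sum>k<n. a k w) - (\<Sum>k. a k w)) * fst h) \<le> tail n * norm h"
            unfolding norm_mult
            using rest[OF sums(1)[OF w] coeff(1)[OF _ w] n(2)] norm_fst_le[of "fst h" "snd h"]
            by (intro mult_mono) (auto intro: order_trans[OF norm_ge_zero])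
          show "cmod (((\<Sum>k<n. b k w) - (\<Sum>k. b k w)) * snd h) \<le> tail n * norm h"
            unfolding norm_mult
            using rest[OF sums(2)[OF w] coeff(2)[OF _ w] n(2)] norm_snd_le[of "snd h" "fst h"]
            by (intro mult_mono) (auto intro: order_trans[OF norm_ge_zero])
        qed
        also have "\<dots> \<le> e * norm h"
          using mult_right_mono[of "2 * tail n" e "norm h"] n(1) by (simp add: algebra_simps)
        finally show "cmod ((\<Sum>k<n. a k w * fst h + b k w * snd h) - g' w h) \<le> e * norm h" .
      qed
    qed
    have "\<exists>s. \<forall>w\<in>ball z r. (\<lambda>k. g k w) sums s w \<and> (s has_derivative g' w) (at w within ball z r)"
    proof (rule has_derivative_series[OF convex_ball _ conv])
      show "(g k has_derivative (\<lambda>h. a k w * fst h + b k w * snd h)) (at w within ball z r)"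
        if "w \<in> ball z r" for k w
        using der[of w k] sub2 that by (meson has_derivative_at_withinI subsetD)
      show "z \<in> ball z r" using r by simp
      show "(\<lambda>k. g k z) sums (\<Sum>k. g k z)"
        using summable_norm_cancel[OF summ[OF z]] by (rule summable_sums)
    qed
    then obtain s where s: "\<And>w. w \<in> ball z r \<Longrightarrow> (\<lambda>k. g k w) sums s w"
      and s': "(s has_derivative g' z) (at z within ball z r)" using r by (meson centre_in_ball)
    have "((\<lambda>w. \<Sum>k. g k w) has_derivative g' z) (at z)"
      using s' r s by (subst at_within_open[OF _ open_ball, of z z r, symmetric])
        (auto intro: has_derivative_transform simp: sums_iff)
    then show "\<exists>a b. ((\<lambda>w. \<Sum>k. g k w) has_derivative (\<lambda>h. a * fst h + b * snd h)) (at z)"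
      unfolding g'_def by blast
  qed
qed

section \<open>Square integrability of series\<close>

lemma open_set_borel_measurable:
  fixes f :: "'a::euclidean_space \<Rightarrow> 'b::{real_normed_vector, second_countable_topology}"
  assumes "open D" "continuous_on D f"
  shows "set_borel_measurable lebesgue D f"
proof -
  have "(\<lambda>x. indicator D x *\<^sub>R f x) \<in> borel_measurable borel"
    using assms by (intro borel_measurable_continuous_on_indicator) auto
  then show ?thesis
    unfolding set_borel_measurable_def by (intro measurable_completion) simp
qed

lemma set_integrable_bounded_continuous:
  fixes f :: "'a::euclidean_space \<Rightarrow> real"
  assumes "open D" "bounded D" "continuous_on D f" "\<And>z. z \<in> D \<Longrightarrow> \<bar>f z\<bar> \<le> B"
  shows "set_integrable lebesgue D f"
proof -
  have "D \<in> sets lebesgue" "emeasure lebesgue D < \<infinity>" using assms(1,2) lmeasurable_open[of D] by (auto simp: fmeasurable_def)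
  then have "set_integrable lebesgue D (\<lambda>z. B)"
    by (auto simp: set_integrable_def fmeasurable_def)
  then show ?thesis
    using assms open_set_borel_measurable[OF assms(1,3)]
    by (elim set_integrable_bound) (auto intro: order_trans[OF _ abs_ge_self])
qed

text \<open>
  Cauchy-Schwarz with the weights \<open>(1/2)\<^sup>k\<close>, whose sum is \<open>2\<close>. It trades the square of a sum for a sum
  of squares, which can be integrated term by term.
\<close>
lemma suminf_power2_le:
  fixes x :: "nat \<Rightarrow> complex"
  assumes x: "summable (\<lambda>k. cmod (x k))" and y: "summable (\<lambda>k. 2 ^ k * (cmod (x k))\<^sup>2)"
  shows "(cmod (\<Sum>k. x k))\<^sup>2 \<le> 2 * (\<Sum>k. 2 ^ k * (cmod (x k))\<^sup>2)"
proof -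
  let ?Y = "\<Sum>k. 2 ^ k * (cmod (x k))\<^sup>2"
  have "(\<Sum>k<n. cmod (x k))\<^sup>2 \<le> 2 * ?Y" for n
  proof -
    have "sqrt ((1/2) ^ k) * (sqrt (2 ^ k) * cmod (x k)) = cmod (x k)" for k
      by (simp add: real_sqrt_mult[symmetric] mult.assoc[symmetric] power_mult_distrib[symmetric])
    then have "(\<Sum>k<n. cmod (x k))\<^sup>2 = (\<Sum>k<n. sqrt ((1/2) ^ k) * (sqrt (2 ^ k) * cmod (x k)))\<^sup>2"
      by (simp only:)
    also have "\<dots> \<le> (\<Sum>k<n. (sqrt ((1/2) ^ k))\<^sup>2) * (\<Sum>k<n. (sqrt (2 ^ k) * cmod (x k))\<^sup>2)"
      by (rule Cauchy_Schwarz_ineq_sum)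
    also have "\<dots> = (\<Sum>k<n. (1/2::real) ^ k) * (\<Sum>k<n. 2 ^ k * (cmod (x k))\<^sup>2)"
      by (simp add: power_mult_distrib)
    also have "\<dots> \<le> 2 * ?Y"
    proof (rule mult_mono)
      have "(\<Sum>k<n. (1/2::real) ^ k) \<le> (\<Sum>k. (1/2) ^ k)"
        by (rule sum_le_suminf) (simp_all add: summable_geometric)
      then show "(\<Sum>k<n. (1/2::real) ^ k) \<le> 2" by (simp add: suminf_geometric)
      show "(\<Sum>k<n. 2 ^ k * (cmod (x k))\<^sup>2) \<le> ?Y"
        by (rule sum_le_suminf[OF y]) simp_all
    qed (simp_all add: sum_nonneg)
    finally show ?thesis .
  qed
  moreover have "(\<lambda>n. (\<Sum>k<n. cmod (x k))\<^sup>2) \<longlonglongrightarrow> (\<Sum>k. cmod (x k))\<^sup>2"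
    by (intro tendsto_power summable_LIMSEQ x)
  ultimately have "(\<Sum>k. cmod (x k))\<^sup>2 \<le> 2 * ?Y"
    by (intro LIMSEQ_le_const2) auto
  moreover have "(cmod (\<Sum>k. x k))\<^sup>2 \<le> (\<Sum>k. cmod (x k))\<^sup>2"
    by (intro power_mono summable_norm x) simp
  ultimately show ?thesis by simp
qed

text \<open>
  The decay \<open>(1/4)\<^sup>k\<close> leaves room for the weights \<open>2\<^sup>k\<close> of \<open>suminf_power2_le\<close>, both pointwise and
  in the integrals.
\<close>
lemma L2h_series:
  assumes D: "open D" and g: "\<And>k. holomorphic2_on (g k) D"
    and small: "\<And>k z. z \<in> inner_part D (1 / Suc k) \<Longrightarrow> cmod (g k z) \<le> (1/4) ^ k"
    and int: "\<And>k. set_integrable lebesgue D (\<lambda>z. (cmod (g k z))\<^sup>2)"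
    and int_le: "\<And>k. (LINT z:D|lebesgue. (cmod (g k z))\<^sup>2) \<le> (1/4) ^ k"
  shows "(\<lambda>z. \<Sum>k. g k z) \<in> L2h D"
proof -
  have quarter: "(1/4::real) ^ k \<le> (1/2) ^ k" for k by (intro power_mono) auto
  have small': "cmod (g k z) \<le> (1/2) ^ k" if "z \<in> inner_part D (1 / Suc k)" for k z
    using small[OF that] quarter[of k] by simp
  have series: "\<And>z. z \<in> D \<Longrightarrow> summable (\<lambda>k. cmod (g k z))" "holomorphic2_on (\<lambda>z. \<Sum>k. g k z) D"
    using holomorphic2_on_series[of D g, OF D g] small' by blast+
  have weighted: "summable (\<lambda>k. 2 ^ k * (cmod (g k z))\<^sup>2)" if z: "z \<in> D" for z
  proof -
    obtain R where R: "R > 0" "ball z R \<subseteq> D" using D z openE by blast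
    obtain N where N: "1 / Suc N < R" using R(1) nat_approx_posE by blast
    have "norm (2 ^ k * (cmod (g k z))\<^sup>2) \<le> (1/2) ^ k" if "k \<ge> N" for k
    proof -
      have "1 / Suc k \<le> 1 / Suc N" using that by (simp add: field_simps)
      then have "ball z (1 / Suc k) \<subseteq> ball z R" using N by (intro subset_ball) linarith
      then have "z \<in> inner_part D (1 / Suc k)" using R by (auto simp: inner_part_def)
      then have "2 ^ k * (cmod (g k z))\<^sup>2 \<le> 2 ^ k * ((1/4) ^ k)\<^sup>2"
        by (intro mult_left_mono power_mono small) auto
      also have "\<dots> = (1/8) ^ k"
        by (simp add: power2_eq_square power_mult_distrib[symmetric])
      also have "\<dots> \<le> (1/2) ^ k" by (intro power_mono) auto
      finally show ?thesis by simp
    qed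
    then show ?thesis
      by (intro summable_comparison_test[OF _ summable_geometric[of "1/2::real"]]) auto
  qed
  define G where "G k z = indicator D z *\<^sub>R (2 ^ k * (cmod (g k z))\<^sup>2)" for k z
  have G: "integrable lebesgue (G k)" for k
    using int[of k] unfolding G_def set_integrable_def[symmetric] by simp
  have "integrable lebesgue (\<lambda>z. \<Sum>k. G k z)"
  proof (rule integrable_suminf[OF G])
    show "AE z in lebesgue. summable (\<lambda>k. norm (G k z))"
    proof (intro AE_I2)
      fix z show "summable (\<lambda>k. norm (G k z))"
        using weighted by (cases "z \<in> D") (auto simp: G_def)
    qed
    have "(\<integral>z. norm (G k z) \<partial>lebesgue) \<le> (1/2) ^ k" for k
    proof -
      have "(\<integral>z. norm (G k z) \<partial>lebesgue) = (LINT z:D|lebesgue. 2 ^ k * (cmod (g k z))\<^sup>2)"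
        unfolding set_lebesgue_integral_def G_def by (intro Bochner_Integration.integral_cong) auto
      also have "\<dots> = 2 ^ k * (LINT z:D|lebesgue. (cmod (g k z))\<^sup>2)" by simp
      also have "\<dots> \<le> 2 ^ k * (1/4) ^ k" by (intro mult_left_mono int_le) simp
      also have "\<dots> = (1/2) ^ k" by (simp add: power_mult_distrib[symmetric])
      finally show ?thesis .
    qed
    then show "summable (\<lambda>k. \<integral>z. norm (G k z) \<partial>lebesgue)"
      by (intro summable_comparison_test[OF _ summable_geometric[of "1/2::real"]])
        (auto intro!: exI[of _ 0] integral_nonneg_AE)
  qed
  moreover have "(\<Sum>k. G k z) = indicator D z *\<^sub>R (\<Sum>k. 2 ^ k * (cmod (g k z))\<^sup>2)" for z
    by (simp add: G_def indicator_def)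
  ultimately have dom: "set_integrable lebesgue D (\<lambda>z. 2 * (\<Sum>k. 2 ^ k * (cmod (g k z))\<^sup>2))"
    by (intro set_integrable_mult_right) (simp add: set_integrable_def)
  have cont: "continuous_on D (\<lambda>z. \<Sum>k. g k z)"
    by (rule holomorphic2_on_imp_continuous_on[OF series(2)])
  have "set_integrable lebesgue D (\<lambda>z. (cmod (\<Sum>k. g k z))\<^sup>2)"
  proof (rule set_integrable_bound[OF dom])
    show "set_borel_measurable lebesgue D (\<lambda>z. (cmod (\<Sum>k. g k z))\<^sup>2)"
      by (intro open_set_borel_measurable D continuous_intros cont)
    show "AE z in lebesgue. z \<in> D \<longrightarrow>
        norm ((cmod (\<Sum>k. g k z))\<^sup>2) \<le> norm (2 * (\<Sum>k. 2 ^ k * (cmod (g k z))\<^sup>2))"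
    proof (intro AE_I2 impI)
      fix z assume z: "z \<in> D"
      from suminf_power2_le[OF series(1)[OF z] weighted[OF z]]
      show "norm ((cmod (\<Sum>k. g k z))\<^sup>2) \<le> norm (2 * (\<Sum>k. 2 ^ k * (cmod (g k z))\<^sup>2))"
        by simp
    qed
  qed
  then show ?thesis
    unfolding L2h_def square_integrable_on_def
    using series(2) open_set_borel_measurable[OF D cont] by blast
qed

section \<open>Weak peak functions and the gliding hump\<close>

text \<open>
  Weaker than a peak function in the usual sense: \<open>h\<close> need not extend continuously to \<open>a\<close>, and its
  modulus may approach \<open>1\<close> at other frontier points as well. At a point of the slit this is what makes
  an approach from one side sufficient.
\<close>
definition weak_peak ::
    "(complex \<times> complex \<Rightarrow> complex) \<Rightarrow> (complex \<times> complex) set \<Rightarrow> complex \<times> complex \<Rightarrow> bool"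
  where "weak_peak h D a \<longleftrightarrow> holomorphic2_on h D \<and> (\<forall>z\<in>D. cmod (h z) < 1) \<and>
    (\<forall>c<1. \<forall>r>0. \<exists>z\<in>D. dist z a < r \<and> c < cmod (h z))"

text \<open>
  The hump is \<open>B h\<^sup>n\<close>. The exponent \<open>n\<close> is chosen first, to make it small on \<open>K\<close> and in the mean; the
  point \<open>p\<close> is chosen afterwards, so close to \<open>a\<close> that \<open>|h(p)|\<^sup>n\<close> still exceeds \<open>1/2\<close>.
\<close>
lemma weak_peak_hump:
  assumes D: "open D" "bounded D" and h: "weak_peak h D a"
    and K: "compact K" "K \<subseteq> D" and e: "0 < e" and r: "0 < r"
  obtains g p B where "holomorphic2_on g D" "\<And>z. z \<in> D \<Longrightarrow> cmod (g z) \<le> B"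
    "\<And>z. z \<in> K \<Longrightarrow> cmod (g z) \<le> e" "(LINT z:D|lebesgue. (cmod (g z))\<^sup>2) \<le> e"
    "p \<in> D" "dist p a < r" "M \<le> cmod (g p)"
proof -
  have holo: "holomorphic2_on h D" and lt1: "\<And>z. z \<in> D \<Longrightarrow> cmod (h z) < 1"
    and peak: "\<And>c. c < 1 \<Longrightarrow> \<exists>z\<in>D. dist z a < r \<and> c < cmod (h z)"
    using h r by (auto simp: weak_peak_def)
  define B where "B = 2 * max M 1"
  have B: "B > 0" "B / 2 \<ge> M" by (auto simp: B_def)
  define g where "g n z = B * h z ^ n" for n z
  have norm_g: "cmod (g n z) = B * cmod (h z) ^ n" for n z
    using B by (simp add: g_def norm_mult norm_power)
  have g_holo: "holomorphic2_on (g n) D" for n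
    unfolding g_def
    by (rule holomorphic2_on_compose[OF holo, where \<phi>="\<lambda>w. B * w ^ n" and U=UNIV])
      (auto intro!: holomorphic_intros)
  have g_le: "cmod (g n z) \<le> B" if "z \<in> D" for n z
    using B lt1[OF that] by (simp add: norm_g mult_left_le power_le_one)
  obtain q where q: "0 \<le> q" "q < 1" "\<And>z. z \<in> K \<Longrightarrow> cmod (h z) \<le> q"
  proof (cases "K = {}")
    case False
    have "continuous_on K (\<lambda>z. cmod (h z))"
      using continuous_on_subset[OF holomorphic2_on_imp_continuous_on[OF holo] K(2)]
      by (rule continuous_on_norm)
    then obtain w where "w \<in> K" "\<forall>z\<in>K. cmod (h z) \<le> cmod (h w)"
      using continuous_attains_sup[OF K(1) False] by blast
    moreover from this K(2) have "cmod (h w) < 1" by (intro lt1) auto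
    ultimately show thesis using that[of "cmod (h w)"] by simp
  qed (use that[of 0] in auto)
  have "(\<lambda>n. B * q ^ n) \<longlonglongrightarrow> B * 0"
    using q by (intro tendsto_mult_left LIMSEQ_power_zero) auto
  then have on_K: "\<forall>\<^sub>F n in sequentially. B * q ^ n < e"
    using e by (intro order_tendstoD(2)) auto
  have "(\<lambda>n. LINT z:D|lebesgue. (cmod (g n z))\<^sup>2) \<longlonglongrightarrow> (LINT z:D|lebesgue. 0)"
    unfolding set_lebesgue_integral_def
  proof (rule integral_dominated_convergence)
    show "integrable lebesgue (\<lambda>z. indicator D z *\<^sub>R B\<^sup>2)"
      using set_integrable_bounded_continuous[OF D, of "\<lambda>z. B\<^sup>2" "B\<^sup>2"]
      by (simp add: set_integrable_def)
    show "(\<lambda>z. indicator D z *\<^sub>R (cmod (g n z))\<^sup>2) \<in> borel_measurable lebesgue" for n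
      unfolding set_borel_measurable_def[symmetric]
      by (intro open_set_borel_measurable D continuous_intros
          holomorphic2_on_imp_continuous_on[OF g_holo])
    show "AE z in lebesgue. (\<lambda>n. indicator D z *\<^sub>R (cmod (g n z))\<^sup>2) \<longlonglongrightarrow> indicator D z *\<^sub>R 0"
    proof (intro AE_I2)
      fix z show "(\<lambda>n. indicator D z *\<^sub>R (cmod (g n z))\<^sup>2) \<longlonglongrightarrow> indicator D z *\<^sub>R 0"
      proof (cases "z \<in> D")
        case True
        have "(\<lambda>n. (B * cmod (h z) ^ n)\<^sup>2) \<longlonglongrightarrow> (B * 0)\<^sup>2"
          using lt1[OF True] by (intro tendsto_power tendsto_mult_left LIMSEQ_power_zero) auto
        with True show ?thesis by (simp add: norm_g)
      qed simp
    qed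
    show "AE z in lebesgue. norm (indicator D z *\<^sub>R (cmod (g n z))\<^sup>2) \<le> indicator D z *\<^sub>R B\<^sup>2" for n
      using g_le by (intro AE_I2) (auto simp: indicator_def intro!: power_mono)
  qed simp
  then have in_L2: "\<forall>\<^sub>F n in sequentially. (LINT z:D|lebesgue. (cmod (g n z))\<^sup>2) < e"
    using e by (intro order_tendstoD(2)) auto
  have "\<forall>\<^sub>F n in sequentially. n > 0 \<and> B * q ^ n < e \<and> (LINT z:D|lebesgue. (cmod (g n z))\<^sup>2) < e"
    using on_K in_L2 eventually_gt_at_top[of 0] by eventually_elim blast
  then obtain n where n: "n > 0" "B * q ^ n < e" "(LINT z:D|lebesgue. (cmod (g n z))\<^sup>2) < e"
    using eventually_happens'[OF sequentially_bot] by blast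
  have "root n (1/2) < 1" using n(1) by simp
  then obtain p where p: "p \<in> D" "dist p a < r" "root n (1/2) < cmod (h p)" using peak by blast
  have "1/2 = root n (1/2) ^ n" using n(1) by simp
  also have "\<dots> \<le> cmod (h p) ^ n" using p(3) n(1) by (intro power_mono) auto
  finally have "B * (1/2) \<le> cmod (g n p)" unfolding norm_g using B(1) by (intro mult_left_mono) auto
  then have "M \<le> cmod (g n p)" using B by simp
  moreover have "cmod (g n z) \<le> e" if "z \<in> K" for z
  proof -
    have "cmod (g n z) \<le> B * q ^ n"
      unfolding norm_g using B(1) q(3)[OF that] by (intro mult_left_mono power_mono) auto
    then show ?thesis using n(2) by simp
  qed
  ultimately show thesis using that[OF g_holo g_le _ _ p(1,2)] n(3) by (meson less_imp_le)
qed

text \<open>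
  For \<open>n > 0\<close> the \<open>n\<close>-th hump is small at all points chosen before, and at its own point \<open>p n\<close> it
  exceeds a global bound for the sum of the moduli of the earlier humps by \<open>n + 2\<close>. The later humps
  contribute at most \<open>2\<close> there.
\<close>
lemma gliding_hump:
  fixes a :: "nat \<Rightarrow> complex \<times> complex"
  assumes D: "open D" "bounded D" and peak: "\<And>n. \<exists>h. weak_peak h D (a n)"
  shows "\<exists>f\<in>L2h D. \<exists>p. \<forall>n. p n \<in> D \<and> dist (p n) (a n) < 1 / Suc n \<and> real n \<le> cmod (f (p n))"
proof -
  \<comment> \<open>A state consists of a hump \<open>g\<close>, its point \<open>p\<close>, a bound \<open>C\<close> for the sum of the moduli of all
    humps so far, and the set \<open>F\<close> of all points so far.\<close>
  define P where "P n = (\<lambda>(g, p, C, F). holomorphic2_on g D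
      \<and> (\<forall>z\<in>inner_part D (1 / Suc n). cmod (g z) \<le> (1/4) ^ n)
      \<and> (LINT z:D|lebesgue. (cmod (g z))\<^sup>2) \<le> (1/4) ^ n
      \<and> p \<in> D \<and> dist p (a n) < 1 / Suc n \<and> finite F \<and> F \<subseteq> D \<and> p \<in> F
      \<and> (\<forall>z\<in>D. cmod (g z) \<le> C))"
    for n :: nat
  define Q where "Q n = (\<lambda>(g :: complex \<times> complex \<Rightarrow> complex, p :: complex \<times> complex, C :: real, F).
      \<lambda>(g', p', C', F'). F \<subseteq> F' \<and> (\<forall>z\<in>F. cmod (g' z) \<le> (1/4) ^ Suc n)
      \<and> C + real n + 3 \<le> cmod (g' p') \<and> (\<forall>z\<in>D. C + cmod (g' z) \<le> C'))"
    for n :: nat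
  have step: "\<exists>g p B. holomorphic2_on g D \<and> (\<forall>z\<in>D. cmod (g z) \<le> B)
      \<and> (\<forall>z\<in>inner_part D (1 / Suc n) \<union> F. cmod (g z) \<le> (1/4) ^ n)
      \<and> (LINT z:D|lebesgue. (cmod (g z))\<^sup>2) \<le> (1/4) ^ n
      \<and> p \<in> D \<and> dist p (a n) < 1 / Suc n \<and> M \<le> cmod (g p)"
    if F: "finite F" "F \<subseteq> D" for n F M
  proof -
    obtain h where h: "weak_peak h D (a n)" using peak by blast
    have K: "compact (inner_part D (1 / Suc n) \<union> F)" "inner_part D (1 / Suc n) \<union> F \<subseteq> D"
      using F inner_part_subset[of "1 / Suc n" D] compact_inner_part[OF D(2), of "1 / Suc n"]
      by (auto intro: compact_Un finite_imp_compact)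
    show ?thesis
      by (rule weak_peak_hump[OF D h K, of "(1/4) ^ n" "1 / Suc n" M]) (simp, simp, blast)
  qed
  have "\<exists>x. P 0 x"
  proof -
    obtain g p B where "holomorphic2_on g D" "\<forall>z\<in>D. cmod (g z) \<le> B"
      "\<forall>z\<in>inner_part D (1 / Suc 0). cmod (g z) \<le> (1/4) ^ 0"
      "(LINT z:D|lebesgue. (cmod (g z))\<^sup>2) \<le> (1/4) ^ 0" "p \<in> D" "dist p (a 0) < 1 / Suc 0"
      using step[of "{}" 0 0] by auto
    then have "P 0 (g, p, B, {p})" unfolding P_def prod.case by blast
    then show ?thesis by blast
  qed
  moreover have "\<exists>y. P (Suc n) y \<and> Q n x y" if "P n x" for x n
  proof -
    obtain g p C F where x: "x = (g, p, C, F)" by (cases x)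
    from that have F: "finite F" "F \<subseteq> D" and C: "0 \<le> C"
      by (auto simp: P_def x intro: order_trans[OF norm_ge_zero])
    obtain g' p' B where g': "holomorphic2_on g' D" "\<forall>z\<in>D. cmod (g' z) \<le> B"
      "\<forall>z\<in>inner_part D (1 / Suc (Suc n)) \<union> F. cmod (g' z) \<le> (1/4) ^ Suc n"
      "(LINT z:D|lebesgue. (cmod (g' z))\<^sup>2) \<le> (1/4) ^ Suc n"
      "p' \<in> D" "dist p' (a (Suc n)) < 1 / Suc (Suc n)" "C + real n + 3 \<le> cmod (g' p')"
      using step[OF F] by metis
    have "P (Suc n) (g', p', C + B, insert p' F)"
      unfolding P_def prod.case using g' F C by (auto intro: add_increasing simp del: of_nat_Suc)
    moreover have "Q n x (g', p', C + B, insert p' F)"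
      unfolding Q_def x prod.case using g' by auto
    ultimately show ?thesis by blast
  qed
  ultimately obtain s where s: "\<And>n. P n (s n)" "\<And>n. Q n (s n) (s (Suc n))"
    using dependent_nat_choice[of P Q] by blast
  define g p C F where "g n = fst (s n)" and "p n = fst (snd (s n))"
    and "C n = fst (snd (snd (s n)))" and "F n = snd (snd (snd (s n)))" for n
  have s_eq: "s n = (g n, p n, C n, F n)" for n by (simp add: g_def p_def C_def F_def)
  have holo: "holomorphic2_on (g n) D"
    and small: "z \<in> inner_part D (1 / Suc n) \<Longrightarrow> cmod (g n z) \<le> (1/4) ^ n"
    and int_le: "(LINT z:D|lebesgue. (cmod (g n z))\<^sup>2) \<le> (1/4) ^ n"
    and p: "p n \<in> D" "dist (p n) (a n) < 1 / Suc n" "p n \<in> F n"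
    and le_C: "z \<in> D \<Longrightarrow> cmod (g n z) \<le> C n" for n z
    using s(1)[of n] unfolding P_def s_eq prod.case by blast+
  have F_Suc: "F n \<subseteq> F (Suc n)"
    and on_F: "z \<in> F n \<Longrightarrow> cmod (g (Suc n) z) \<le> (1/4) ^ Suc n"
    and large: "C n + real n + 3 \<le> cmod (g (Suc n) (p (Suc n)))"
    and C_Suc: "z \<in> D \<Longrightarrow> C n + cmod (g (Suc n) z) \<le> C (Suc n)" for n z
    using s(2)[of n] unfolding Q_def s_eq prod.case by blast+
  have sum_le_C: "(\<Sum>k<Suc n. cmod (g k z)) \<le> C n" if "z \<in> D" for n z
  proof (induction n)
    case 0 show ?case using le_C[OF that, of 0] by simp
  next
    case (Suc n) then show ?case using C_Suc[OF that, of n] by simp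
  qed
  have later: "cmod (g k (p n)) \<le> (1/4) ^ k" if less: "n < k" for n k
  proof -
    obtain m where m: "k = Suc m" "n \<le> m" using less by (metis Suc_le_D less_eq_Suc_le Suc_le_mono)
    have "F n \<subseteq> F m" using m(2) F_Suc by (rule lift_Suc_mono_le[rotated])
    then show ?thesis unfolding m(1) using p(3) by (intro on_F) blast
  qed
  have cont: "continuous_on D (g n)" for n
    by (rule holomorphic2_on_imp_continuous_on[OF holo])
  have int: "set_integrable lebesgue D (\<lambda>z. (cmod (g n z))\<^sup>2)" for n
    by (rule set_integrable_bounded_continuous[OF D, where B="(C n)\<^sup>2"])
      (auto intro!: continuous_intros cont power_mono le_C)
  define f where "f z = (\<Sum>k. g k z)" for z
  have "f \<in> L2h D"
    unfolding f_def by (rule L2h_series[OF D(1) holo small int int_le])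
  moreover have "real n \<le> cmod (f (p n))" for n
  proof (cases n)
    case 0 then show ?thesis by simp
  next
    case (Suc m)
    let ?z = "p n"
    have quarter: "cmod (g (k + Suc n) ?z) \<le> (1/2) ^ k" for k
    proof -
      have "cmod (g (k + Suc n) ?z) \<le> (1/4) ^ (k + Suc n)" by (rule later) simp
      also have "\<dots> \<le> (1/4) ^ k" by (rule power_decreasing) auto
      also have "\<dots> \<le> (1/2) ^ k" by (intro power_mono) auto
      finally show ?thesis .
    qed
    have geo: "summable (\<lambda>k. (1/2::real) ^ k)" by (simp add: summable_geometric)
    have summ: "summable (\<lambda>k. g k ?z)"
      using summable_comparison_test[OF _ geo, of "\<lambda>k. g (k + Suc n) ?z"] quarter
      by (subst summable_iff_shift[symmetric, of _ "Suc n"]) blast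
    have "f ?z = (\<Sum>k. g (k + Suc n) ?z) + (\<Sum>k<n. g k ?z) + g n ?z"
      unfolding f_def using suminf_split_initial_segment[OF summ, of "Suc n"] by simp
    then have eq: "g n ?z = f ?z - (\<Sum>k. g (k + Suc n) ?z) - (\<Sum>k<n. g k ?z)" by simp
    have "cmod (g n ?z) \<le> cmod (f ?z) + cmod (\<Sum>k. g (k + Suc n) ?z) + cmod (\<Sum>k<n. g k ?z)"
      unfolding eq
      using norm_triangle_ineq4[of "f ?z" "\<Sum>k. g (k + Suc n) ?z"]
        norm_triangle_ineq4[of "f ?z - (\<Sum>k. g (k + Suc n) ?z)" "\<Sum>k<n. g k ?z"] by linarith
    moreover have "cmod (\<Sum>k. g (k + Suc n) ?z) \<le> 2"
      using norm_suminf_le[OF quarter geo] by (simp add: suminf_geometric)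
    moreover have "cmod (\<Sum>k<n. g k ?z) \<le> C m"
      using sum_le_C[OF p(1), of n m] unfolding Suc by (intro order_trans[OF norm_sum])
    ultimately show ?thesis using large[of m] Suc by simp
  qed
  ultimately show ?thesis using p(1,2) by blast
qed

text \<open>
  The sequence of target points enumerates a countable dense subset of \<open>A\<close> through a pairing
  function, so that each of its points is visited at arbitrarily late times.
\<close>
lemma L2h_unbounded_at:
  assumes D: "open D" "bounded D" and peak: "\<And>a. a \<in> A \<Longrightarrow> \<exists>h. weak_peak h D a" and "A \<noteq> {}"
  shows "\<exists>f\<in>L2h D. \<forall>a\<in>A. \<forall>M. \<forall>r>0. \<exists>z\<in>D. dist z a < r \<and> M < cmod (f z)"
proof -
  obtain T where T: "countable T" "T \<subseteq> A" "A \<subseteq> closure T" using separable by blast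
  with \<open>A \<noteq> {}\<close> have "T \<noteq> {}" by auto
  define a where "a n = from_nat_into T (fst (prod_decode n))" for n
  have "a n \<in> A" for n using from_nat_into[OF \<open>T \<noteq> {}\<close>] T(2) by (auto simp: a_def)
  then obtain f p where f: "f \<in> L2h D"
    and p: "\<And>n. p n \<in> D" "\<And>n. dist (p n) (a n) < 1 / Suc n" "\<And>n. real n \<le> cmod (f (p n))"
    using gliding_hump[OF D, of a] peak by metis
  have "\<exists>z\<in>D. dist z b < r \<and> M < cmod (f z)" if b: "b \<in> A" and r: "r > 0" for b M r
  proof -
    obtain t where t: "t \<in> T" "dist t b < r / 2"
      using b T(3) r closure_approachable[of b T] by (metis half_gt_zero subsetD)
    obtain N where N: "1 / Suc N < r / 2" using r nat_approx_posE[of "r / 2"] by auto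
    obtain L :: nat where L: "M < real L" using reals_Archimedean2 by blast
    define n where "n = prod_encode (to_nat_on T t, max N L)"
    have "a n = t" using t(1) T(1) by (simp add: a_def n_def)
    moreover have n: "max N L \<le> n" unfolding n_def by (rule le_prod_encode_2)
    moreover have "1 / Suc n \<le> 1 / Suc N" using n by (simp add: field_simps)
    ultimately have "dist (p n) t < r / 2" using p(2)[of n] N by simp
    then have "dist (p n) b < r" using t(2) dist_triangle[of "p n" b t] by simp
    moreover have "M < cmod (f (p n))" using p(3)[of n] L n by simp
    ultimately show ?thesis using p(1) by blast
  qed
  with f show ?thesis by blast
qed

section \<open>Holomorphic curves tangent to a family of ellipses\<close>

text \<open>
  In the coordinate \<open>u = 2 (z\<^sub>1 - 1)\<close> the ellipse over \<open>v\<close> has half-axes \<open>1\<close> (real direction) and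
  \<open>axis_ratio v\<close> (imaginary direction).
\<close>
definition axis_ratio :: "complex \<Rightarrow> real"
  where "axis_ratio v = sqrt ((1 - (cmod v)\<^sup>2) / (1 + (cmod v)\<^sup>2))"

lemma disc_power2_less_1: "v \<in> ball 0 1 \<Longrightarrow> (cmod v)\<^sup>2 < 1"
  by (simp add: power_less_one_iff abs_square_less_1)

lemma axis_ratio_pos: "v \<in> ball 0 1 \<Longrightarrow> 0 < axis_ratio v"
  using disc_power2_less_1[of v] by (simp add: axis_ratio_def add_pos_nonneg)

text \<open>
  The function \<open>p v = sqrt ((1 - w v\<^sup>2) / (1 + w v\<^sup>2))\<close> coincides with \<open>axis_ratio\<close> where \<open>w v\<^sup>2\<close> is real and
  nonnegative, and the unimodular \<open>w\<close> turns \<open>v0\<close> into such a point. Elsewhere on the same circle neither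
  the modulus nor the real part of the quotient is smaller, and the square of the real part of the
  principal root is the mean of these two.
\<close>
lemma axis_ratio_majorant:
  assumes v0: "v0 \<in> ball 0 1"
  obtains p where "p holomorphic_on ball 0 1" "p v0 = of_real (axis_ratio v0)"
    "\<And>v. v \<in> ball 0 1 \<Longrightarrow> axis_ratio v \<le> Re (p v)"
proof -
  define w where "w = (if v0 = 0 then 1 else cnj v0 / v0)"
  have w: "cmod w = 1" "w * v0\<^sup>2 = of_real ((cmod v0)\<^sup>2)"
    by (auto simp: w_def norm_divide power2_eq_square complex_norm_square[unfolded power2_eq_square]
        simp flip: of_real_mult)
  define J where "J v = (1 - w * v\<^sup>2) / (1 + w * v\<^sup>2)" for v
  define p where "p v = csqrt (J v)" for v
  have norm_w: "cmod (w * v\<^sup>2) = (cmod v)\<^sup>2" for v by (simp add: norm_mult norm_power w)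
  have nz: "1 + w * v\<^sup>2 \<noteq> 0" if "v \<in> ball 0 1" for v
  proof
    assume "1 + w * v\<^sup>2 = 0"
    then have "w * v\<^sup>2 = -1" by (simp add: add_eq_0_iff)
    then show False using norm_w[of v] disc_power2_less_1[OF that] by simp
  qed
  have J: "(1 - (cmod v)\<^sup>2) / (1 + (cmod v)\<^sup>2) \<le> Re (J v)"
    "(1 - (cmod v)\<^sup>2) / (1 + (cmod v)\<^sup>2) \<le> cmod (J v)" "0 < Re (J v)" if v: "v \<in> ball 0 1" for v
  proof -
    let ?m = "(cmod v)\<^sup>2" and ?y = "w * v\<^sup>2"
    have m: "?m < 1" by (rule disc_power2_less_1[OF v])
    have pos: "0 < cmod (1 + ?y)" using nz[OF v] by simp
    have up: "cmod (1 + ?y) \<le> 1 + ?m" using norm_triangle_ineq[of 1 ?y] norm_w by simp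
    have "Re (J v) = Re ((1 - ?y) * cnj (1 + ?y)) / (cmod (1 + ?y))\<^sup>2"
      unfolding J_def complex_div_cnj[of "1 - ?y"]
      by (metis Re_divide_of_real of_real_power)
    also have "Re ((1 - ?y) * cnj (1 + ?y)) = 1 - (cmod ?y)\<^sup>2"
      unfolding cmod_power2 by (simp add: power2_eq_square algebra_simps)
    also have "\<dots> = (1 - ?m) * (1 + ?m)"
      by (simp only: norm_w) (simp add: power2_eq_square algebra_simps)
    finally have Re: "Re (J v) = (1 - ?m) * (1 + ?m) / (cmod (1 + ?y))\<^sup>2" .
    have "(1 - ?m) / (1 + ?m) = (1 - ?m) * (1 + ?m) / (1 + ?m)\<^sup>2"
      using add_pos_nonneg[of 1 ?m] by (simp add: power2_eq_square)
    also have "\<dots> \<le> Re (J v)"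
      unfolding Re using m pos up by (intro divide_left_mono mult_pos_pos power_mono) (auto simp: add_pos_nonneg)
    finally show *: "(1 - ?m) / (1 + ?m) \<le> Re (J v)" .
    then show "(1 - ?m) / (1 + ?m) \<le> cmod (J v)"
      using complex_Re_le_cmod[of "J v"] by linarith
    have "0 < (1 - ?m) / (1 + ?m)" using m by (simp add: add_pos_nonneg)
    with * show "0 < Re (J v)" by linarith
  qed
  show thesis
  proof
    show "p holomorphic_on ball 0 1"
      unfolding p_def
    proof (intro holomorphic_on_csqrt')
      show "J holomorphic_on ball 0 1" unfolding J_def by (intro holomorphic_intros nz)
      show "J v \<notin> \<real>\<^sub>\<le>\<^sub>0" if "v \<in> ball 0 1" for v
        using J(3)[OF that] by (simp add: complex_nonpos_Reals_iff)
    qed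
    show "p v0 = of_real (axis_ratio v0)"
    proof -
      let ?r = "(1 - (cmod v0)\<^sup>2) / (1 + (cmod v0)\<^sup>2)"
      have "0 \<le> ?r" using disc_power2_less_1[OF v0] by (simp add: add_pos_nonneg)
      moreover have "J v0 = of_real ?r" unfolding J_def w(2) by simp
      ultimately show ?thesis unfolding p_def axis_ratio_def by (simp only: of_real_sqrt)
    qed
    show "axis_ratio v \<le> Re (p v)" if "v \<in> ball 0 1" for v
    proof -
      have "r \<le> (y + x) / 2" if "r \<le> x" "r \<le> y" for r x y :: real using that by simp
      then show ?thesis
        unfolding p_def axis_ratio_def csqrt.simps by (intro real_sqrt_le_mono) (use J(1,2)[OF that] in blast)
    qed
  qed
qed

lemma Re_csqrt_pos:
  assumes "z \<notin> \<real>\<^sub>\<le>\<^sub>0"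
  shows "0 < Re (csqrt z)"
proof -
  have "0 < cmod z + Re z"
  proof (rule ccontr)
    assume "\<not> 0 < cmod z + Re z"
    then have *: "cmod z = \<bar>Re z\<bar>" "Re z \<le> 0" using abs_Re_le_cmod[of z] by linarith+
    then have "Im z = 0" using cmod_power2[of z] by simp
    then show False using * assms by (simp add: complex_nonpos_Reals_iff)
  qed
  then show ?thesis by simp
qed

text \<open>
  For real \<open>p\<close> the line \<open>p (1 - x X) = s Y\<close> is the tangent at \<open>(x, p s)\<close> of the ellipse with half-axes
  \<open>1\<close> and \<open>p\<close>. The curve \<open>T\<close> stays on the outer side of the line with parameter \<open>Re p\<close> and passes through
  the point of contact for \<open>p = k\<close>. For \<open>x \<noteq> 0\<close> and \<open>c = x / s\<close> the inequality says that
  \<open>1 - x T\<close> has argument of modulus at least \<open>arctan (\<bar>c\<bar> Re p)\<close>, and the choice \<open>1 - x T = C exp (- \<i> arctan (c p))\<close>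
  achieves this because \<open>Re (arctan z) \<ge> arctan (Re z)\<close> for \<open>Re z > 0\<close>. Below, the exponential is
  written algebraically as a square root \<open>g\<close> of \<open>(1 - \<i> c p) / (1 + \<i> c p)\<close>, and the inequality for the
  arctangent becomes \<open>2 Re g \<le> |1 + g\<^sup>2|\<close>.
\<close>
lemma half_plane_tangent_curve:
  fixes x s k :: real
  assumes xs: "x\<^sup>2 + s\<^sup>2 = 1" and s: "0 < s" and k: "0 < k"
  obtains T where "T holomorphic_on {p. 0 < Re p}" "T (of_real k) = Complex x (k * s)"
    "\<And>p. 0 < Re p \<Longrightarrow> 0 < Im (T p)" "\<And>p. 0 < Re p \<Longrightarrow> Re p * (1 - x * Re (T p)) \<le> s * Im (T p)"
proof (cases "x = 0")
  case True
  then have "s = 1" using xs s by (simp add: power2_eq_1_iff)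
  show thesis
  proof
    show "(\<lambda>p. \<i> * p) holomorphic_on {p. 0 < Re p}" by (intro holomorphic_intros)
  qed (use True \<open>s = 1\<close> in \<open>auto simp: complex_eq_iff\<close>)
next
  case False
  define c where "c = x / s"
  have c: "c \<noteq> 0" "x = c * s" using False s by (auto simp: c_def)
  define J where "J p = (1 - \<i> * c * p) / (1 + \<i> * c * p)" for p :: complex
  define g where "g p = csqrt (J p)" for p
  define C where "C = s\<^sup>2 * sqrt (1 + c\<^sup>2 * k\<^sup>2)"
  have C: "0 < C" using s by (simp add: C_def add_pos_nonneg)
  define T where "T p = (1 - C * g p) / x" for p
  have nz: "1 + \<i> * c * p \<noteq> 0" if "0 < Re p" for p
    using that c(1) by (auto simp: complex_eq_iff)
  have g_sq: "(g p)\<^sup>2 * (1 + \<i> * c * p) = 1 - \<i> * c * p" if "0 < Re p" for p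
    using nz[OF that] by (simp add: g_def J_def)
  \<comment> \<open>The relation between \<open>p\<close> and \<open>g\<close> solved for \<open>c p\<close>: real part, cleared of the denominator.\<close>
  have key: "c * Re p * (cmod (1 + (g p)\<^sup>2))\<^sup>2 = - (4 * Re (g p) * Im (g p))"
    and N: "0 < (cmod (1 + (g p)\<^sup>2))\<^sup>2" if p: "0 < Re p" for p
  proof -
    let ?G = "(g p)\<^sup>2"
    have imag: "Re (- \<i> * (1 - G) * cnj (1 + G)) = - 2 * Im G" for G
      by (simp add: algebra_simps)
    have eq: "c * p * (1 + ?G) = - \<i> * (1 - ?G)"
    proof -
      have "\<i> * (c * p * (1 + ?G)) = \<i> * (- \<i> * (1 - ?G))"
        using g_sq[OF p] by (simp add: algebra_simps)
      then show ?thesis by (simp only: mult_cancel_left) simp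
    qed
    have "1 + ?G \<noteq> 0"
    proof
      assume "1 + ?G = 0"
      moreover from this eq have "1 - ?G = 0" by simp
      ultimately have "(1 + ?G) + (1 - ?G) = 0" by (simp only: add_0)
      then show False by simp
    qed
    then show "0 < (cmod (1 + ?G))\<^sup>2" by simp
    have "c * p * ((1 + ?G) * cnj (1 + ?G)) = - \<i> * (1 - ?G) * cnj (1 + ?G)"
      using eq by (simp only: mult.assoc[symmetric])
    then have "c * p * of_real ((cmod (1 + ?G))\<^sup>2) = - \<i> * (1 - ?G) * cnj (1 + ?G)"
      by (simp only: complex_norm_square)
    then have "Re (c * p * of_real ((cmod (1 + ?G))\<^sup>2)) = Re (- \<i> * (1 - ?G) * cnj (1 + ?G))"
      by (rule arg_cong)
    also have "Re (- \<i> * (1 - ?G) * cnj (1 + ?G)) = - 2 * Im ?G"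
      by (rule imag)
    also have "Im ?G = 2 * Re (g p) * Im (g p)" by (simp add: power2_eq_square)
    finally show "c * Re p * (cmod (1 + ?G))\<^sup>2 = - (4 * Re (g p) * Im (g p))" by simp
  qed
  have g_pos: "0 < Re (g p)" if "0 < Re p" for p
  proof -
    have "Re (g p) \<noteq> 0" using key[OF that] N[OF that] c(1) that by auto
    moreover have "0 \<le> Re (g p)" unfolding g_def by (rule Re_csqrt)
    ultimately show ?thesis by simp
  qed
  have four: "4 * (Re (g p))\<^sup>2 \<le> (cmod (1 + (g p)\<^sup>2))\<^sup>2" for p
  proof -
    have "(cmod (1 + (g p)\<^sup>2))\<^sup>2 - 4 * (Re (g p))\<^sup>2 = (1 - (Re (g p))\<^sup>2 - (Im (g p))\<^sup>2)\<^sup>2"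
      unfolding cmod_power2 by (simp add: power2_eq_square algebra_simps)
    then show ?thesis by (metis diff_ge_0_iff_ge zero_le_power2)
  qed
  \<comment> \<open>Normalised so that \<open>s Im (T p) = C t p\<close> whatever the sign of \<open>c\<close>.\<close>
  define t where "t p = - Im (g p) / c" for p
  have t: "Re p * (cmod (1 + (g p)\<^sup>2))\<^sup>2 = 4 * Re (g p) * t p" if "0 < Re p" for p
    using key[OF that] c(1) by (simp add: t_def field_simps)
  have t_pos: "0 < t p" if "0 < Re p" for p
  proof -
    have "0 < 4 * Re (g p) * t p" unfolding t[OF that, symmetric] using that N[OF that] by simp
    then show ?thesis using g_pos[OF that] by (simp add: zero_less_mult_iff)
  qed
  have ReT: "1 - x * Re (T p) = C * Re (g p)" for p
    using False by (simp add: T_def)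
  have ImT: "s * Im (T p) = C * t p" for p
    using False s c by (simp add: T_def t_def field_simps)
  show thesis
  proof
    show "T holomorphic_on {p. 0 < Re p}"
      unfolding T_def g_def
    proof (intro holomorphic_intros holomorphic_on_csqrt')
      show "J holomorphic_on {p. 0 < Re p}"
        unfolding J_def by (intro holomorphic_intros) (use nz in auto)
      fix p assume p: "p \<in> {p. 0 < Re p}"
      show "J p \<notin> \<real>\<^sub>\<le>\<^sub>0"
      proof
        assume "J p \<in> \<real>\<^sub>\<le>\<^sub>0"
        then have "Re (g p) = 0"
          unfolding g_def by (auto simp: complex_nonpos_Reals_iff cmod_eq_Re)
        then show False using g_pos[of p] p by simp
      qed
    qed (use False in auto)
    show "0 < Im (T p)" if "0 < Re p" for p
    proof -
      have "0 < s * Im (T p)" unfolding ImT using C t_pos[OF that] by simp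
      then show ?thesis using s by (simp add: zero_less_mult_iff)
    qed
    show "Re p * (1 - x * Re (T p)) \<le> s * Im (T p)" if p: "0 < Re p" for p
    proof -
      let ?N = "(cmod (1 + (g p)\<^sup>2))\<^sup>2"
      have "(Re p * Re (g p)) * ?N = t p * (4 * (Re (g p))\<^sup>2)"
        using t[OF p] by (simp add: power2_eq_square algebra_simps)
      also have "\<dots> \<le> t p * ?N" using t_pos[OF p] four[of p] by (intro mult_left_mono) auto
      finally have "Re p * Re (g p) \<le> t p" using N[OF p] by simp
      then have "C * (Re p * Re (g p)) \<le> C * t p" using C by (intro mult_left_mono) auto
      then show ?thesis unfolding ReT ImT by (simp add: algebra_simps)
    qed
    show "T (of_real k) = Complex x (k * s)"
    proof -
      define R where "R = sqrt (1 + c\<^sup>2 * k\<^sup>2)"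
      have R: "R > 0" "R\<^sup>2 = 1 + c\<^sup>2 * k\<^sup>2" by (auto simp: R_def add_pos_nonneg)
      have "((1 - \<i> * c * k) / R)\<^sup>2 = J k"
      proof -
        have "(complex_of_real R)\<^sup>2 = 1 + c\<^sup>2 * k\<^sup>2" using R(2) by (metis of_real_1 of_real_add of_real_mult of_real_power)
        also have "\<dots> = (1 - \<i> * c * k) * (1 + \<i> * c * k)"
          by (simp add: power2_eq_square algebra_simps)
        finally show ?thesis
          using nz[of k] k R(1) by (simp add: J_def power_divide power2_eq_square divide_simps)
      qed
      then have "g k = (1 - \<i> * c * k) / R"
        unfolding g_def by (intro csqrt_unique) (use R(1) in auto)
      then have "C * g k = s\<^sup>2 * (1 - \<i> * c * k)"
        using R(1) by (simp add: C_def R_def[symmetric])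
      then have "T k = (1 - s\<^sup>2 * (1 - \<i> * c * k)) / x" by (simp add: T_def)
      also have "\<dots> = Complex x (k * s)"
      proof -
        have "1 - s * s = x * x" using xs by (simp add: power2_eq_square)
        then show ?thesis using False s by (simp add: complex_eq_iff power2_eq_square c_def)
      qed
      finally show ?thesis .
    qed
  qed
qed

text \<open>
  Composition of the two preceding constructions. Since the real part of the parameter dominates
  \<open>axis_ratio v\<close>, the curve lies beyond a tangent line of the ellipse over \<open>v\<close>, and Cauchy-Schwarz turns
  this into the statement that it lies outside that ellipse.
\<close>
lemma tangent_curve:
  fixes x s :: real
  assumes v0: "v0 \<in> ball 0 1" and xs: "x\<^sup>2 + s\<^sup>2 = 1" "0 < s"
  obtains q where "q holomorphic_on ball 0 1" "q v0 = Complex x (axis_ratio v0 * s)"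
    "\<And>v. v \<in> ball 0 1 \<Longrightarrow> 0 < Im (q v)"
    "\<And>v. v \<in> ball 0 1 \<Longrightarrow> 1 \<le> (Re (q v))\<^sup>2 + (Im (q v) / axis_ratio v)\<^sup>2"
proof -
  obtain p where p: "p holomorphic_on ball 0 1" "p v0 = of_real (axis_ratio v0)"
    "\<And>v. v \<in> ball 0 1 \<Longrightarrow> axis_ratio v \<le> Re (p v)"
    using axis_ratio_majorant[OF v0] by blast
  obtain T where T: "T holomorphic_on {p. 0 < Re p}"
    "T (of_real (axis_ratio v0)) = Complex x (axis_ratio v0 * s)"
    "\<And>p. 0 < Re p \<Longrightarrow> 0 < Im (T p)" "\<And>p. 0 < Re p \<Longrightarrow> Re p * (1 - x * Re (T p)) \<le> s * Im (T p)"
    using half_plane_tangent_curve[OF xs axis_ratio_pos[OF v0]] by blast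
  have p_pos: "0 < Re (p v)" if "v \<in> ball 0 1" for v
    using p(3)[OF that] axis_ratio_pos[OF that] by linarith
  show thesis
  proof
    show "(\<lambda>v. T (p v)) holomorphic_on ball 0 1"
    proof -
      have "p ` ball 0 1 \<subseteq> {p. 0 < Re p}" using p_pos by blast
      from holomorphic_on_compose_gen[OF p(1) T(1) this] show ?thesis by (simp only: o_def)
    qed
    show "T (p v0) = Complex x (axis_ratio v0 * s)" unfolding p(2) T(2) ..
    fix v :: complex assume v: "v \<in> ball 0 1"
    have lagrange: "(x * X + s * Y)\<^sup>2 + (x * Y - s * X)\<^sup>2 = (x\<^sup>2 + s\<^sup>2) * (X\<^sup>2 + Y\<^sup>2)" for X Y
      by (simp add: power2_eq_square algebra_simps)
    let ?X = "Re (T (p v))" and ?Y = "Im (T (p v)) / axis_ratio v"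
    show pos: "0 < Im (T (p v))" by (rule T(3)[OF p_pos[OF v]])
    have k: "0 < axis_ratio v" by (rule axis_ratio_pos[OF v])
    have "axis_ratio v * (1 - x * ?X) \<le> s * Im (T (p v))"
    proof (cases "0 \<le> 1 - x * ?X")
      case True
      then show ?thesis using mult_right_mono[OF p(3)[OF v] True] T(4)[OF p_pos[OF v]] by linarith
    next
      case False
      then have "axis_ratio v * (1 - x * ?X) < 0" using k by (simp add: mult_less_0_iff)
      then show ?thesis using pos xs(2) by (smt (verit) mult_nonneg_nonneg)
    qed
    then have "1 \<le> x * ?X + s * ?Y" using k by (simp add: field_simps)
    then have "1 \<le> (x * ?X + s * ?Y)\<^sup>2" by simp
    also have "\<dots> \<le> (x * ?X + s * ?Y)\<^sup>2 + (x * ?Y - s * ?X)\<^sup>2" by simp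
    also have "\<dots> = (x\<^sup>2 + s\<^sup>2) * (?X\<^sup>2 + ?Y\<^sup>2)" by (rule lagrange)
    finally show "1 \<le> ?X\<^sup>2 + ?Y\<^sup>2" by (simp add: xs(1))
  qed
qed

section \<open>The slit domain and a branch of the logarithm on it\<close>

text \<open>
  The slit lies in the level set \<open>1/4\<close>. The sublevel set \<open>slit_level z < 1/4\<close> is the full interior of
  the ellipses, including the part in the lower half plane.
\<close>
definition slit_level :: "complex \<times> complex \<Rightarrow> real"
  where "slit_level z =
    (Re (fst z) - 1)\<^sup>2 + (1 + (cmod (snd z))\<^sup>2) / (1 - (cmod (snd z))\<^sup>2) * (Im (fst z))\<^sup>2"

lemma slit_level_axis_ratio:
  assumes "snd z \<in> ball 0 1"
  shows "slit_level z = (Re (fst z) - 1)\<^sup>2 + (Im (fst z) / axis_ratio (snd z))\<^sup>2"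
proof -
  have "(axis_ratio (snd z))\<^sup>2 = (1 - (cmod (snd z))\<^sup>2) / (1 + (cmod (snd z))\<^sup>2)"
    using disc_power2_less_1[OF assms] by (simp add: axis_ratio_def add_pos_nonneg)
  then show ?thesis by (simp add: slit_level_def power_divide)
qed

lemma slit_coefficient_ge_1:
  assumes "v \<in> ball (0::complex) 1"
  shows "1 \<le> (1 + (cmod v)\<^sup>2) / (1 - (cmod v)\<^sup>2)"
  using disc_power2_less_1[OF assms] by (simp add: le_divide_eq)

abbreviation "ambient \<equiv> annulus_P \<times> ball (0::complex) 1"

lemma open_ambient: "open ambient"
proof -
  have "annulus_P = - cball 0 (1/2) \<inter> ball 0 (3/2)" by (auto simp: annulus_P_def)
  then have "open annulus_P" by (metis closed_cball open_Compl open_Int open_ball)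
  then show ?thesis by (intro open_Times open_ball)
qed

lemma continuous_on_slit_level: "continuous_on ambient slit_level"
  unfolding slit_level_def
  by (intro continuous_intros) (auto dest!: disc_power2_less_1)

definition dom_inside :: "(complex \<times> complex) set"
  where "dom_inside = {z \<in> ambient. slit_level z < 1/4}"
definition dom_outside :: "(complex \<times> complex) set"
  where "dom_outside = {z \<in> ambient. 1/4 < slit_level z}"
definition dom_lower :: "(complex \<times> complex) set"
  where "dom_lower = {z \<in> ambient. Im (fst z) < 0}"

lemma open_dom_parts: "open dom_inside" "open dom_outside" "open dom_lower"
proof -
  have "open (ambient \<inter> slit_level -` {..<1/4})" "open (ambient \<inter> slit_level -` {1/4<..})"
    by (intro continuous_open_preimage continuous_on_slit_level open_ambient open_lessThan open_greaterThan)+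
  moreover have "open (ambient \<inter> (\<lambda>z. Im (fst z)) -` {..<0})"
    by (intro continuous_open_preimage open_ambient continuous_intros open_lessThan)
  moreover have "dom_inside = ambient \<inter> slit_level -` {..<1/4}"
    "dom_outside = ambient \<inter> slit_level -` {1/4<..}"
    "dom_lower = ambient \<inter> (\<lambda>z. Im (fst z)) -` {..<0}"
    by (auto simp: dom_inside_def dom_outside_def dom_lower_def)
  ultimately show "open dom_inside" "open dom_outside" "open dom_lower" by simp_all
qed

lemma slit_S_eq: "slit_S = {z \<in> ambient. slit_level z = 1/4 \<and> 0 < Im (fst z)}"
  by (auto simp: slit_S_def slit_level_def)

text \<open>
  The remaining points would have level \<open>1/4\<close> and real \<open>z\<^sub>1\<close>. These are the end points \<open>1/2\<close> and
  \<open>3/2\<close> of the arcs, which the open annulus excludes.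
\<close>
lemma dom_D_eq: "dom_D = dom_inside \<union> dom_outside \<union> dom_lower"
proof -
  have "Im (fst z) \<noteq> 0" if z: "z \<in> ambient" "slit_level z = 1/4" for z
  proof
    assume 0: "Im (fst z) = 0"
    with z have "(Re (fst z) - 1)\<^sup>2 = (1/2)\<^sup>2" by (simp add: slit_level_def power_divide)
    then have "Re (fst z) = 1/2 \<or> Re (fst z) = 3/2" by (auto simp: power2_eq_iff)
    moreover have "cmod (fst z) = \<bar>Re (fst z)\<bar>" using 0 by (rule cmod_eq_Re)
    ultimately show False using z(1) by (auto simp: annulus_P_def)
  qed
  then have "slit_level z < 1/4 \<or> 1/4 < slit_level z \<or> Im (fst z) < 0"
    if "z \<in> ambient" "\<not> (slit_level z = 1/4 \<and> 0 < Im (fst z))" for z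
    using that by (meson linorder_neqE_linordered_idom)
  then show ?thesis
    unfolding dom_D_def slit_S_eq dom_inside_def dom_outside_def dom_lower_def by auto
qed

lemma open_dom_D: "open dom_D"
  unfolding dom_D_eq using open_dom_parts by auto

lemma bounded_ambient: "bounded ambient"
proof -
  have "annulus_P \<subseteq> ball 0 (3/2)" by (auto simp: annulus_P_def)
  then show ?thesis by (intro bounded_Times bounded_ball) (rule bounded_subset[OF bounded_ball])
qed

lemma dom_D_subset: "dom_D \<subseteq> ambient" by (auto simp: dom_D_def)

text \<open>
  Principal logarithm under the arc and in the lower half plane; above the arc, the argument is
  taken in \<open>(-2 \<pi>, -\<pi>]\<close>. Both sides of the arc thus lie on different sheets.
\<close>
definition log_branch :: "complex \<times> complex \<Rightarrow> complex"
  where "log_branch z =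
    (if slit_level z < 1/4 \<or> Im (fst z) < 0 then Ln (fst z) else Ln (- fst z) - \<i> * pi)"

lemma Re_pos_inside:
  assumes "z \<in> ambient" "slit_level z < 1/4"
  shows "1/2 < Re (fst z)"
proof -
  have "(Re (fst z) - 1)\<^sup>2 \<le> slit_level z"
    using assms(1) by (subst slit_level_axis_ratio) auto
  then have "(Re (fst z) - 1)\<^sup>2 < (1/2)\<^sup>2" using assms(2) by (simp add: power_divide)
  then have "\<bar>Re (fst z) - 1\<bar> < 1/2" 
    using power2_less_imp_less[of "\<bar>Re (fst z) - 1\<bar>" "1/2"] by simp
  then show ?thesis by linarith
qed

lemma holomorphic2_on_log_branch: "holomorphic2_on log_branch dom_D"
proof -
  have Ln_fst: "holomorphic2_on (\<lambda>z. Ln (fst z)) U" if "\<And>z. z \<in> U \<Longrightarrow> fst z \<notin> \<real>\<^sub>\<le>\<^sub>0" for U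
    by (rule holomorphic2_on_compose[OF holomorphic2_on_fst holomorphic_on_Ln, of "- \<real>\<^sub>\<le>\<^sub>0"])
      (use that in auto)
  have "0 < Re (fst z)" if "z \<in> dom_inside" for z
    using Re_pos_inside[of z] that by (simp add: dom_inside_def)
  then have "holomorphic2_on log_branch dom_inside"
    by (intro holomorphic2_on_cong[OF Ln_fst])
      (fastforce simp: dom_inside_def log_branch_def complex_nonpos_Reals_iff)+
  moreover have "holomorphic2_on log_branch dom_lower"
    by (rule holomorphic2_on_cong[OF Ln_fst])
      (auto simp: dom_lower_def log_branch_def complex_nonpos_Reals_iff)
  moreover have "holomorphic2_on log_branch dom_outside"
  proof (rule holomorphic2_on_cong)
    have "- fst z \<notin> \<real>\<^sub>\<le>\<^sub>0" if z: "z \<in> dom_outside" for z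
    proof
      assume "- fst z \<in> \<real>\<^sub>\<le>\<^sub>0"
      then have Im: "Im (fst z) = 0" and Re: "0 \<le> Re (fst z)" by (auto simp: complex_nonpos_Reals_iff)
      from Im Re have "cmod (fst z) = Re (fst z)" by (simp add: cmod_eq_Re)
      then have "1/2 < Re (fst z)" "Re (fst z) < 3/2" using z by (auto simp: dom_outside_def annulus_P_def)
      then have "\<bar>Re (fst z) - 1\<bar> < 1/2" by linarith
      then have "(Re (fst z) - 1)\<^sup>2 < (1/2)\<^sup>2" by (metis abs_ge_zero power2_abs power_strict_mono zero_less_numeral)
      then show False using z Im by (auto simp: dom_outside_def slit_level_def power_divide)
    qed
    then show "holomorphic2_on (\<lambda>z. Ln (- fst z) - \<i> * pi) dom_outside"
      by (intro holomorphic2_on_compose[OF holomorphic2_on_fst, of "\<lambda>w. Ln (- w) - \<i> * pi" "{w. - w \<notin> \<real>\<^sub>\<le>\<^sub>0}"])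
        (auto intro!: holomorphic_intros open_Collect_neg simp: )
    show "log_branch z = Ln (- fst z) - \<i> * pi" if z: "z \<in> dom_outside" for z
    proof (cases "Im (fst z) < 0")
      case True
      then have "fst z \<noteq> 0" by auto
      with True show ?thesis by (simp add: log_branch_def Ln_minus)
    next
      case False
      then show ?thesis using z by (simp add: log_branch_def dom_outside_def)
    qed
  qed
  ultimately show ?thesis
    unfolding dom_D_eq by (intro holomorphic2_on_Un open_dom_parts open_Un)
qed

text \<open>
  Rotating a point of the right half plane towards the positive real axis decreases the level: at
  fixed modulus, \<open>slit_level\<close> is a decreasing function of the real part and an increasing one of the
  squared imaginary part.
\<close>
lemma slit_level_mono_Arg:
  assumes z: "snd z = v" "0 < Re (fst z)" and b: "snd b = v" and v: "v \<in> ball 0 1"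
    and norm: "cmod (fst b) = cmod (fst z)" and Re: "Re (fst z) \<le> Re (fst b)"
  shows "slit_level b \<le> slit_level z"
proof -
  define K where "K = (1 + (cmod v)\<^sup>2) / (1 - (cmod v)\<^sup>2)"
  have K: "1 \<le> K" unfolding K_def by (rule slit_coefficient_ge_1[OF v])
  have Im: "(Im (fst z))\<^sup>2 = (cmod (fst z))\<^sup>2 - (Re (fst z))\<^sup>2"
    "(Im (fst b))\<^sup>2 = (cmod (fst z))\<^sup>2 - (Re (fst b))\<^sup>2"
    using cmod_power2[of "fst z"] cmod_power2[of "fst b"] norm by simp_all
  have level: "slit_level z = (cmod (fst z))\<^sup>2 - 2 * Re (fst z) + 1 + (K - 1) * (Im (fst z))\<^sup>2"
    "slit_level b = (cmod (fst z))\<^sup>2 - 2 * Re (fst b) + 1 + (K - 1) * (Im (fst b))\<^sup>2"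
    unfolding slit_level_def z(1) b K_def[symmetric]
    using Im by (simp_all add: power2_eq_square algebra_simps)
  have "(Im (fst b))\<^sup>2 \<le> (Im (fst z))\<^sup>2"
    unfolding Im using z(2) Re by (simp add: power_mono)
  then have "(K - 1) * (Im (fst b))\<^sup>2 \<le> (K - 1) * (Im (fst z))\<^sup>2"
    using K by (intro mult_left_mono) auto
  then show ?thesis unfolding level using Re by simp
qed

text \<open>
  Let \<open>log_branch z = Ln b + \<i> t\<close> with \<open>t \<ge> 0\<close>. Then the imaginary part of the branch at \<open>z\<close> is positive,
  so \<open>z\<close> lies under the arc, and \<open>b\<close> arises from \<open>z\<^sub>1\<close> by a rotation towards the positive real axis.
  So \<open>b\<close> would lie inside the ellipse too.
\<close>
lemma log_branch_avoids_ray: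
  assumes z: "z \<in> dom_D" and b: "0 < Im b" "1/4 \<le> slit_level (b, snd z)"
  shows "\<i> * (log_branch z - Ln b) \<notin> \<real>\<^sub>\<le>\<^sub>0"
proof
  assume "\<i> * (log_branch z - Ln b) \<in> \<real>\<^sub>\<le>\<^sub>0"
  then have Re: "Re (log_branch z) = Re (Ln b)" and Im: "Im (Ln b) \<le> Im (log_branch z)"
    by (auto simp: complex_nonpos_Reals_iff)
  have amb: "z \<in> ambient" using z dom_D_subset by blast
  then have nz: "fst z \<noteq> 0" "b \<noteq> 0" using b(1) by (auto simp: annulus_P_def)
  have Im_b: "0 < Im (Ln b)" using Im_Ln_pos_lt[OF nz(2)] b(1) by blast
  have inner: "slit_level z < 1/4 \<or> Im (fst z) < 0"
  proof (rule ccontr)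
    assume "\<not> ?thesis"
    then have "Im (log_branch z) \<le> 0"
      using Im_Ln_le_pi[of "- fst z"] nz by (auto simp: log_branch_def)
    then show False using Im Im_b by linarith
  qed
  then have log: "log_branch z = Ln (fst z)" by (simp add: log_branch_def)
  have "0 \<le> Im (fst z)"
    using Im_Ln_pos_le[OF nz(1)] Im_Ln_le_pi[OF nz(1)] Im Im_b unfolding log by linarith
  with inner have level: "slit_level z < 1/4" by simp
  have norm: "cmod b = cmod (fst z)"
    using Re nz unfolding log by (simp add: Re_Ln)
  have Re_eq: "Re w = cmod w * cos (Im (Ln w))" if "w \<noteq> 0" for w
    using that by (metis Re_exp Re_Ln exp_Ln exp_ln zero_less_norm_iff)
  have "cos (Im (Ln (fst z))) \<le> cos (Im (Ln b))"
    using Im Im_b Im_Ln_le_pi[OF nz(1)] unfolding log by (intro cos_monotone_0_pi_le) auto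
  then have "Re (fst z) \<le> Re b"
    unfolding Re_eq[OF nz(1)] Re_eq[OF nz(2)] norm by (intro mult_left_mono) auto
  then have "slit_level (b, snd z) \<le> slit_level z"
    using amb Re_pos_inside[OF amb level] norm
    by (intro slit_level_mono_Arg[of z "snd z" "(b, snd z)"]) auto
  then show False using level b(2) by linarith
qed

text \<open>
  The curve \<open>b\<close> is the tangent curve in the coordinate \<open>z\<^sub>1\<close>. The point \<open>a\<close> is approached from inside
  the ellipse, along the segment from the centre \<open>1\<close>; there the branch is principal and \<open>F\<close> tends
  to \<open>0\<close>.
\<close>
lemma weak_peak_slit:
  assumes a: "a \<in> slit_S"
  shows "\<exists>h. weak_peak h dom_D a"
proof -
  obtain a1 a2 where a_eq: "a = (a1, a2)" by (cases a)
  have amb: "a1 \<in> annulus_P" "a2 \<in> ball 0 1" and level: "slit_level (a1, a2) = 1/4" and Im: "0 < Im a1"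
    using a by (auto simp: slit_S_eq a_eq)
  define k where "k = axis_ratio a2"
  have k: "0 < k" unfolding k_def by (rule axis_ratio_pos[OF amb(2)])
  define x s where "x = 2 * (Re a1 - 1)" and "s = 2 * Im a1 / k"
  have xs: "x\<^sup>2 + s\<^sup>2 = 1" "0 < s"
  proof -
    have "x\<^sup>2 = 4 * (Re a1 - 1)\<^sup>2" "s\<^sup>2 = 4 * (Im a1 / k)\<^sup>2"
      by (simp_all add: x_def s_def power2_eq_square algebra_simps)
    then have "x\<^sup>2 + s\<^sup>2 = 4 * slit_level (a1, a2)"
      using slit_level_axis_ratio[of "(a1, a2)"] amb(2) by (simp add: k_def)
    then show "x\<^sup>2 + s\<^sup>2 = 1" using level by simp
    show "0 < s" using Im k by (simp add: s_def)
  qed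
  obtain q where q: "q holomorphic_on ball 0 1" "q a2 = Complex x (k * s)"
    "\<And>v. v \<in> ball 0 1 \<Longrightarrow> 0 < Im (q v)"
    "\<And>v. v \<in> ball 0 1 \<Longrightarrow> 1 \<le> (Re (q v))\<^sup>2 + (Im (q v) / axis_ratio v)\<^sup>2"
    using tangent_curve[OF amb(2) xs] unfolding k_def by blast
  define b where "b v = 1 + q v / 2" for v
  have b_Im: "0 < Im (b v)" if "v \<in> ball 0 1" for v using q(3)[OF that] by (simp add: b_def)
  have b_a2: "b a2 = a1"
    using k by (simp add: b_def q(2) x_def s_def complex_eq_iff field_simps)
  have b_level: "1/4 \<le> slit_level (b v, v)" if v: "v \<in> ball 0 1" for v
  proof -
    have "4 * slit_level (b v, v) = (Re (q v))\<^sup>2 + (Im (q v) / axis_ratio v)\<^sup>2"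
      using slit_level_axis_ratio[of "(b v, v)"] v by (simp add: b_def power2_eq_square)
    then show ?thesis using q(4)[OF v] by simp
  qed
  define F where "F z = log_branch z - Ln (b (snd z))" for z
  have snd: "snd z \<in> ball 0 1" if "z \<in> dom_D" for z using that dom_D_subset by auto
  have F_holo: "holomorphic2_on F dom_D"
    unfolding F_def
  proof (intro holomorphic2_on_diff holomorphic2_on_log_branch)
    have "(\<lambda>v. Ln (b v)) holomorphic_on ball 0 1"
    proof (rule holomorphic_on_Ln')
      show "b holomorphic_on ball 0 1" unfolding b_def by (intro holomorphic_intros q(1)) auto
      show "b v \<notin> \<real>\<^sub>\<le>\<^sub>0" if "v \<in> ball 0 1" for v
        using b_Im[OF that] by (auto simp: complex_nonpos_Reals_iff)
    qed
    from holomorphic2_on_compose[OF holomorphic2_on_snd this open_ball snd]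
    show "holomorphic2_on (\<lambda>z. Ln (b (snd z))) dom_D" .
  qed
  have F_ray: "\<i> * F z \<notin> \<real>\<^sub>\<le>\<^sub>0" if "z \<in> dom_D" for z
    unfolding F_def by (rule log_branch_avoids_ray[OF that b_Im b_level]) (rule snd[OF that])+
  define h where "h z = 1 / (1 + csqrt (\<i> * F z))" for z
  have Re_gt: "1 < Re (1 + csqrt (\<i> * F z))" if "z \<in> dom_D" for z
    using Re_csqrt_pos[OF F_ray[OF that]] by simp
  have h_holo: "holomorphic2_on h dom_D"
    unfolding h_def
  proof (rule holomorphic2_on_compose[OF F_holo, of "\<lambda>w. 1 / (1 + csqrt (\<i> * w))" "{w. \<i> * w \<notin> \<real>\<^sub>\<le>\<^sub>0}"])
    show "(\<lambda>w. 1 / (1 + csqrt (\<i> * w))) holomorphic_on {w. \<i> * w \<notin> \<real>\<^sub>\<le>\<^sub>0}"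
    proof (intro holomorphic_intros holomorphic_on_csqrt')
      fix w assume "w \<in> {w. \<i> * w \<notin> \<real>\<^sub>\<le>\<^sub>0}"
      then have pos: "0 < Re (csqrt (\<i> * w))" by (intro Re_csqrt_pos) simp
      show "1 + csqrt (\<i> * w) \<noteq> 0"
      proof
        assume "1 + csqrt (\<i> * w) = 0"
        from arg_cong[OF this, of Re] have "1 + Re (csqrt (\<i> * w)) = 0"
          by (simp only: plus_complex.sel one_complex.sel zero_complex.sel)
        with pos show False by linarith
      qed
    qed auto
    have "open ((\<lambda>w. \<i> * w) -` (- \<real>\<^sub>\<le>\<^sub>0))"
      by (intro open_vimage open_Compl closed_nonpos_Reals_complex continuous_intros)
    then show "open {w. \<i> * w \<notin> \<real>\<^sub>\<le>\<^sub>0}" by (simp add: vimage_def)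
  qed (use F_ray in auto)
  have h_lt: "cmod (h z) < 1" if "z \<in> dom_D" for z
  proof -
    have "1 < cmod (1 + csqrt (\<i> * F z))"
      using Re_gt[OF that] complex_Re_le_cmod by (rule less_le_trans)
    then show ?thesis
      unfolding h_def norm_divide norm_one by (subst divide_less_eq_1_pos) linarith+
  qed
  define \<gamma> where "\<gamma> t = (1 + of_real t * (a1 - 1), a2)" for t :: real
  have \<gamma>_tendsto: "(\<gamma> \<longlongrightarrow> a) (at_left 1)"
  proof -
    have "(\<gamma> \<longlongrightarrow> (1 + of_real 1 * (a1 - 1), a2)) (at_left 1)"
      unfolding \<gamma>_def by (intro tendsto_intros)
    then show ?thesis by (simp add: a_eq)
  qed
  have \<gamma>_level: "slit_level (\<gamma> t) = t\<^sup>2 / 4" for t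
  proof -
    have scale: "(t * A)\<^sup>2 + K * (t * I)\<^sup>2 = t\<^sup>2 * (A\<^sup>2 + K * I\<^sup>2)" for A I K :: real
      by (simp add: power2_eq_square algebra_simps)
    have "Re (fst (\<gamma> t)) - 1 = t * (Re a1 - 1)" "Im (fst (\<gamma> t)) = t * Im a1" "snd (\<gamma> t) = a2"
      by (simp_all add: \<gamma>_def)
    then have "slit_level (\<gamma> t) = t\<^sup>2 * slit_level (a1, a2)"
      by (simp only: slit_level_def fst_conv snd_conv scale)
    then show ?thesis by (simp add: level)
  qed
  have near: "cmod (a1 - 1) \<le> 1/2"
  proof -
    have "(cmod (a1 - 1))\<^sup>2 \<le> slit_level (a1, a2)"
      using mult_right_mono[OF slit_coefficient_ge_1[OF amb(2)], of "(Im a1)\<^sup>2"]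
      by (simp add: cmod_power2 slit_level_def)
    then have "(cmod (a1 - 1))\<^sup>2 \<le> (1/2)\<^sup>2" unfolding level by (simp add: power_divide)
    then show ?thesis by (rule power2_le_imp_le) simp
  qed
  have \<gamma>_in: "\<gamma> t \<in> dom_inside" if t: "0 < t" "t < 1" for t
  proof -
    have "cmod (of_real t * (a1 - 1)) = t * cmod (a1 - 1)" using t by (simp add: norm_mult)
    also have "\<dots> \<le> t * (1/2)" using t near by (intro mult_left_mono) auto
    finally have "cmod (of_real t * (a1 - 1)) < 1/2" using t by simp
    then have "fst (\<gamma> t) \<in> annulus_P"
      using norm_triangle_ineq[of 1 "of_real t * (a1 - 1)"]
        norm_diff_ineq[of 1 "of_real t * (a1 - 1)"]
      by (simp add: annulus_P_def \<gamma>_def)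
    moreover have "t\<^sup>2 < 1" using t by (simp add: power_less_one_iff)
    ultimately show ?thesis
      using amb(2) \<gamma>_level[of t] by (simp add: dom_inside_def \<gamma>_def)
  qed
  have F_tendsto: "((\<lambda>t. F (\<gamma> t)) \<longlongrightarrow> 0) (at_left 1)"
  proof -
    have "((\<lambda>t. Ln (fst (\<gamma> t)) - Ln a1) \<longlongrightarrow> Ln (fst a) - Ln a1) (at_left 1)"
      using Im by (intro tendsto_intros \<gamma>_tendsto) (auto simp: a_eq complex_nonpos_Reals_iff)
    moreover have "\<forall>\<^sub>F t in at_left 1. Ln (fst (\<gamma> t)) - Ln a1 = F (\<gamma> t)"
      using eventually_at_left_field[THEN iffD2, of 1 "\<lambda>t. 0 < t \<and> t < 1"]
    proof (rule eventually_mono)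
      show "\<exists>b<1::real. \<forall>y>b. y < 1 \<longrightarrow> 0 < y \<and> y < 1" by (intro exI[of _ 0]) auto
      fix t :: real assume "0 < t \<and> t < 1"
      then have "slit_level (\<gamma> t) < 1/4" using \<gamma>_in[of t] by (simp add: dom_inside_def)
      then show "Ln (fst (\<gamma> t)) - Ln a1 = F (\<gamma> t)"
        by (simp add: F_def log_branch_def) (simp add: \<gamma>_def b_a2)
    qed
    ultimately show ?thesis by (simp add: a_eq tendsto_cong)
  qed
  have "((\<lambda>t. csqrt (\<i> * F (\<gamma> t))) \<longlongrightarrow> 0) (at_left 1)"
  proof (rule tendsto_norm_zero_cancel)
    have "((\<lambda>t. sqrt (cmod (F (\<gamma> t)))) \<longlongrightarrow> sqrt (cmod 0)) (at_left 1)"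
      by (intro tendsto_intros F_tendsto)
    then show "((\<lambda>t. cmod (csqrt (\<i> * F (\<gamma> t)))) \<longlongrightarrow> 0) (at_left 1)"
      by (simp add: norm_mult)
  qed
  then have "((\<lambda>t. cmod (h (\<gamma> t))) \<longlongrightarrow> cmod (1 / (1 + 0))) (at_left 1)"
    unfolding h_def by (intro tendsto_intros) auto
  then have h_tendsto: "((\<lambda>t. cmod (h (\<gamma> t))) \<longlongrightarrow> 1) (at_left 1)" by simp
  have "\<exists>z\<in>dom_D. dist z a < r \<and> c < cmod (h z)" if "c < 1" "0 < r" for c r
  proof -
    have "\<forall>\<^sub>F t in at_left 1. c < cmod (h (\<gamma> t))" using h_tendsto \<open>c < 1\<close> by (rule order_tendstoD)
    moreover have "\<forall>\<^sub>F t in at_left 1. dist (\<gamma> t) a < r" using \<gamma>_tendsto \<open>0 < r\<close> by (rule tendstoD)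
    moreover have "\<forall>\<^sub>F t in at_left (1::real). 0 < t \<and> t < 1"
      unfolding eventually_at_left_field by (intro exI[of _ 0]) auto
    ultimately have "\<forall>\<^sub>F t in at_left 1. \<gamma> t \<in> dom_D \<and> dist (\<gamma> t) a < r \<and> c < cmod (h (\<gamma> t))"
      by eventually_elim (use \<gamma>_in dom_D_eq in blast)
    then show ?thesis using eventually_happens'[OF trivial_limit_at_left_real] by blast
  qed
  then show ?thesis unfolding weak_peak_def using h_holo h_lt by blast
qed

section \<open>Unboundedness at the whole frontier\<close>

lemma weak_peakI_continuous:
  assumes "holomorphic2_on h D" "\<And>z. z \<in> D \<Longrightarrow> cmod (h z) < 1"
    and a: "a \<in> closure D" "isCont h a" "cmod (h a) = 1"
  shows "weak_peak h D a"
proof -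
  have "\<exists>z\<in>D. dist z a < r \<and> c < cmod (h z)" if "c < 1" "0 < r" for c r
  proof -
    have "((\<lambda>z. cmod (h z)) \<longlongrightarrow> cmod (h a)) (nhds a)"
      using a(2) by (intro tendsto_norm) (simp add: isCont_def tendsto_at_iff_tendsto_nhds)
    then have "\<forall>\<^sub>F z in nhds a. c < cmod (h z)"
      using that a(3) by (intro order_tendstoD(1)) auto
    then obtain d where d: "d > 0" "\<And>z. dist z a < d \<Longrightarrow> c < cmod (h z)"
      unfolding eventually_nhds_metric by blast
    obtain z where "z \<in> D" "dist z a < min d r"
      using a(1) d(1) \<open>0 < r\<close> closure_approachable[of a D] by (metis min_less_iff_conj)
    then show ?thesis using d(2) by (metis min_less_iff_conj)
  qed
  then show ?thesis unfolding weak_peak_def using assms(1,2) by blast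
qed

lemma weak_peak_frontier_dom_D:
  assumes a: "a \<in> frontier dom_D"
  shows "\<exists>h. weak_peak h dom_D a"
proof -
  have cl: "a \<in> closure dom_D" and notin: "a \<notin> dom_D"
    using a open_dom_D by (auto simp: frontier_def interior_open)
  obtain a1 a2 where a_eq: "a = (a1, a2)" by (cases a)
  have "closure dom_D \<subseteq> {w. 1/2 \<le> cmod w \<and> cmod w \<le> 3/2} \<times> cball 0 1"
  proof (rule closure_minimal)
    show "dom_D \<subseteq> {w. 1/2 \<le> cmod w \<and> cmod w \<le> 3/2} \<times> cball 0 1"
      by (auto simp: dom_D_def annulus_P_def)
    show "closed ({w. 1/2 \<le> cmod w \<and> cmod w \<le> 3/2} \<times> cball (0::complex) 1)"
      by (intro closed_Times closed_Collect_conj closed_Collect_le continuous_intros) auto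
  qed
  then have bounds: "1/2 \<le> cmod a1" "cmod a1 \<le> 3/2" "cmod a2 \<le> 1" using cl by (auto simp: a_eq)
  have dom: "1/2 < cmod (fst z)" "cmod (fst z) < 3/2" "cmod (snd z) < 1" if "z \<in> dom_D" for z
    using that dom_D_subset by (auto simp: annulus_P_def)
  consider "cmod a2 = 1" | "cmod a1 = 3/2" | "cmod a1 = 1/2" | "a \<in> slit_S"
    using bounds notin by (fastforce simp: dom_D_def annulus_P_def a_eq)
  then show ?thesis
  proof cases
    case 1
    have "weak_peak snd dom_D a"
      by (rule weak_peakI_continuous[OF holomorphic2_on_snd _ cl])
        (use dom 1 in \<open>auto simp: a_eq intro: continuous_intros\<close>)
    then show ?thesis by blast
  next
    case 2
    have "holomorphic2_on (\<lambda>z. fst z / (3/2)) dom_D"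
      by (rule holomorphic2_on_compose[OF holomorphic2_on_fst, where \<phi>="\<lambda>w. w / (3/2)" and U=UNIV])
        (auto intro!: holomorphic_intros)
    then have "weak_peak (\<lambda>z. fst z / (3/2)) dom_D a"
      by (rule weak_peakI_continuous[OF _ _ cl])
        (use dom 2 in \<open>auto simp: a_eq norm_divide intro!: continuous_intros\<close>)
    then show ?thesis by blast
  next
    case 3
    have "holomorphic2_on (\<lambda>z. (1/2) / fst z) dom_D"
      by (rule holomorphic2_on_compose[OF holomorphic2_on_fst, where \<phi>="\<lambda>w. (1/2) / w" and U="- {0}"])
        (use dom(1) in \<open>fastforce intro!: holomorphic_intros\<close>)+
    moreover have "cmod ((1/2) / fst z) < 1" if "z \<in> dom_D" for z
      using dom(1)[OF that] by (simp add: norm_divide divide_simps)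
    moreover have "isCont (\<lambda>z. (1/2) / fst z) a"
      using 3 by (intro continuous_intros) (auto simp: a_eq)
    ultimately have "weak_peak (\<lambda>z. (1/2) / fst z) dom_D a"
      using 3 by (intro weak_peakI_continuous cl) (auto simp: a_eq norm_divide)
    then show ?thesis by blast
  next
    case 4
    then show ?thesis by (rule weak_peak_slit)
  qed
qed

lemma Limsup_eq_infinity:
  fixes f :: "'a::metric_space \<Rightarrow> 'b::real_normed_vector"
  assumes "a \<notin> D" and unbdd: "\<And>M r. r > 0 \<Longrightarrow> \<exists>z\<in>D. dist z a < r \<and> M < norm (f z)"
  shows "Limsup (at a within D) (\<lambda>z. ereal (norm (f z))) = \<infinity>"
proof -
  have "ereal M \<le> Limsup (at a within D) (\<lambda>z. ereal (norm (f z)))" for M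
  proof (rule Limsup_greatest)
    fix P assume "eventually P (at a within D)"
    then obtain d where d: "d > 0" "\<And>z. z \<in> D \<Longrightarrow> z \<noteq> a \<Longrightarrow> dist z a < d \<Longrightarrow> P z"
      unfolding eventually_at by blast
    obtain z where z: "z \<in> D" "dist z a < d" "M < norm (f z)" using unbdd[OF d(1)] by blast
    then have "P z" using d(2) \<open>a \<notin> D\<close> by blast
    then show "ereal M \<le> (SUP z\<in>Collect P. ereal (norm (f z)))"
      using z(3) by (intro SUP_upper2[of z]) auto
  qed
  then show ?thesis by (intro ereal_top) blast
qed

theorem theorem7:
  "\<exists>f \<in> L2h dom_D. \<forall>a \<in> frontier dom_D. Limsup (at a within dom_D) (\<lambda>z. ereal (cmod (f z))) = \<infinity>"
proof -
  have bdd: "bounded dom_D" using bounded_ambient dom_D_subset by (rule bounded_subset)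
  have "(1, 0) \<in> dom_D" by (simp add: dom_D_def annulus_P_def slit_S_def)
  then have "frontier dom_D \<noteq> {}"
    using bdd not_bounded_UNIV by (auto simp: frontier_eq_empty)
  from L2h_unbounded_at[OF open_dom_D bdd weak_peak_frontier_dom_D this]
  obtain f where f: "f \<in> L2h dom_D"
    and unbdd: "\<forall>a\<in>frontier dom_D. \<forall>M. \<forall>r>0. \<exists>z\<in>dom_D. dist z a < r \<and> M < cmod (f z)"
    by blast
  have "Limsup (at a within dom_D) (\<lambda>z. ereal (cmod (f z))) = \<infinity>" if a: "a \<in> frontier dom_D" for a
  proof (rule Limsup_eq_infinity)
    show "a \<notin> dom_D" using a open_dom_D by (auto simp: frontier_def interior_open)
  qed (use unbdd a in blast)
  with f show ?thesis by blast
qed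

end
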